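(* Let $G$ be a totally disconnected locally compact (Hausdorff) group and let $\Gamma$ be a generalised $FC^-$-group which acts continuously on $G$ by automorphisms. Then the following are equivalent: 1. The $\Gamma$-action on $G$ is distal. 2. The $\Gamma$-action on $G$ has [MOC]. 3. The $\Gamma$-action on $G$ is equicontinuous.
   Context: A locally compact group $L$ is a generalised $FC^-$-group if it has closed normal subgroups $L=L_0\supset L_1\supset\cdots\supset L_n=\{e\}$ such that for each $i=0,\ldots,n-1$, $L_i/L_{i+1}$ is a compactly generated group with relatively compact conjugacy classes. An action of $\Gamma$ by continuous self-maps on a Hausdorff space $X$ is distal if for any two distinct points $x,y\in X$, the closure of $\{(\gamma(x),\gamma(y))\mid\gamma\in\Gamma\}$ in $X\times X$ does not intersect the diagonal. It has [MOC] (minimal orbit closures) if the closure of every $\Gamma$-orbit is a minimal closed $\Gamma$-invariant set, i.e. for $x,y\in X$, if $y\in\overline{\Gamma(x)}$ then $\overline{\Gamma(y)}=\overline{\Gamma(x)}$, where $\Gamma(x)=\{\gamma(x)\mid\gamma\in\Gamma\}$. The action of a group $\Gamma$ on $G$ by automorphisms is equicontinuous if there exists a neighbourhood base at the identity $e$ of $G$ consisting of $\Gamma$-invariant neighbourhoods. Automorphisms of a topological group are group automorphisms that are homeomorphisms. *)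

theory Defs
  imports "HOL-Analysis.Analysis" "HOL-Algebra.Generated_Groups" "HOL-Algebra.Group_Action"
begin

locale topological_group = group G for G (structure) +
  fixes T :: "'a topology"
  assumes topspace_eq_carrier: "topspace T = carrier G"
    and continuous_mult: "continuous_map (prod_topology T T) T (\<lambda>(x, y). x \<otimes> y)"
    and continuous_inv: "continuous_map T T (\<lambda>x. inv x)"

locale locally_compact_group = topological_group +
  assumes locally_compact: "locally_compact_space T"
    and Hausdorff: "Hausdorff_space T"

definition totally_disconnected_space :: "'a topology \<Rightarrow> bool" where
  "totally_disconnected_space X \<longleftrightarrow> (\<forall>S. connectedin X S \<longrightarrow> (\<exists>a. S \<subseteq> {a}))"

definition quotient_topology :: "'a topology \<Rightarrow> ('a \<Rightarrow> 'b) \<Rightarrow> 'b topology" where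
  "quotient_topology X f =
     topology (\<lambda>U. U \<subseteq> f ` topspace X \<and> openin X {x \<in> topspace X. f x \<in> U})"

lemma openin_quotient_topology:
  "openin (quotient_topology X f) U \<longleftrightarrow>
     U \<subseteq> f ` topspace X \<and> openin X {x \<in> topspace X. f x \<in> U}"
proof -
  have "istopology (\<lambda>U. U \<subseteq> f ` topspace X \<and> openin X {x \<in> topspace X. f x \<in> U})"
    unfolding istopology_def
  proof (intro conjI allI impI; (elim conjE)?)
    fix S T
    assume "openin X {x \<in> topspace X. f x \<in> S}" "openin X {x \<in> topspace X. f x \<in> T}"
    moreover have "{x \<in> topspace X. f x \<in> S \<inter> T} =
        {x \<in> topspace X. f x \<in> S} \<inter> {x \<in> topspace X. f x \<in> T}"
      by auto
    ultimately show "openin X {x \<in> topspace X. f x \<in> S \<inter> T}"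
      by (simp only: openin_Int)
  next
    fix \<K>
    assume "\<forall>K\<in>\<K>. K \<subseteq> f ` topspace X \<and> openin X {x \<in> topspace X. f x \<in> K}"
    moreover have "{x \<in> topspace X. f x \<in> \<Union>\<K>} = (\<Union>K\<in>\<K>. {x \<in> topspace X. f x \<in> K})"
      by auto
    ultimately show "openin X {x \<in> topspace X. f x \<in> \<Union>\<K>}"
      by auto
  qed auto
  then show ?thesis
    by (simp add: quotient_topology_def)
qed

lemma topspace_quotient_topology: "topspace (quotient_topology X f) = f ` topspace X"
proof
  show "topspace (quotient_topology X f) \<subseteq> f ` topspace X"
    using openin_quotient_topology[of X f] openin_topspace by blast
  have "{x \<in> topspace X. f x \<in> f ` topspace X} = topspace X"
    by auto
  then have "openin (quotient_topology X f) (f ` topspace X)"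
    by (simp add: openin_quotient_topology)
  then show "f ` topspace X \<subseteq> topspace (quotient_topology X f)"
    by (rule openin_subset)
qed

lemma quotient_map_quotient_topology: "quotient_map X (quotient_topology X f) f"
  by (auto simp: quotient_map_def topspace_quotient_topology openin_quotient_topology)

definition compactly_generated :: "('a, 'm) monoid_scheme \<Rightarrow> 'a topology \<Rightarrow> bool" where
  "compactly_generated G T \<longleftrightarrow> (\<exists>K. compactin T K \<and> generate G K = carrier G)"

definition conjugacy_class :: "('a, 'm) monoid_scheme \<Rightarrow> 'a \<Rightarrow> 'a set" where
  "conjugacy_class G x = {g \<otimes>\<^bsub>G\<^esub> x \<otimes>\<^bsub>G\<^esub> inv\<^bsub>G\<^esub> g | g. g \<in> carrier G}"

definition relatively_compact_conjugacy_classes ::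
    "('a, 'm) monoid_scheme \<Rightarrow> 'a topology \<Rightarrow> bool" where
  "relatively_compact_conjugacy_classes G T \<longleftrightarrow>
     (\<forall>x\<in>carrier G. compactin T (T closure_of conjugacy_class G x))"

text \<open>The members of the chain are normal in the whole group. The factor
  \<open>L\<^sub>i / L\<^sub>i\<^sub>+\<^sub>1\<close> carries the quotient topology of the subspace topology on
  \<open>L\<^sub>i\<close>. Inclusions in the chain need not be strict.\<close>

definition generalised_FC_group :: "('a, 'm) monoid_scheme \<Rightarrow> 'a topology \<Rightarrow> bool" where
  "generalised_FC_group G T \<longleftrightarrow>
     locally_compact_group G T \<and>
     (\<exists>(n::nat) L. L 0 = carrier G \<and> L n = {\<one>\<^bsub>G\<^esub>} \<and>
        (\<forall>i\<le>n. L i \<lhd> G \<and> closedin T (L i)) \<and>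
        (\<forall>i<n. L (Suc i) \<subseteq> L i \<and>
           (let Gi = G\<lparr>carrier := L i\<rparr>;
                Q = Gi Mod L (Suc i);
                TQ = quotient_topology (subtopology T (L i)) (\<lambda>x. L (Suc i) #>\<^bsub>Gi\<^esub> x)
            in compactly_generated Q TQ \<and> relatively_compact_conjugacy_classes Q TQ)))"

text \<open>Continuity of the action is joint continuity of \<open>(\<gamma>, x) \<mapsto> \<gamma>(x)\<close>. Membership in
  \<open>AutoGroup G\<close> includes the convention that each \<open>\<phi> \<gamma>\<close> is \<open>undefined\<close> off \<open>carrier G\<close>.\<close>

locale continuous_automorphism_action =
  \<Gamma>: topological_group \<Gamma> S + G: topological_group G T
  for \<Gamma> :: "('g, 'm) monoid_scheme" and S :: "'g topology"
    and G :: "('a, 'n) monoid_scheme" and T :: "'a topology" +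
  fixes \<phi> :: "'g \<Rightarrow> 'a \<Rightarrow> 'a"
  assumes action_hom: "\<phi> \<in> hom \<Gamma> (AutoGroup G)"
    and action_homeomorphic: "\<gamma> \<in> carrier \<Gamma> \<Longrightarrow> homeomorphic_map T T (\<phi> \<gamma>)"
    and action_continuous: "continuous_map (prod_topology S T) T (\<lambda>(\<gamma>, x). \<phi> \<gamma> x)"

definition distal_action ::
    "('g, 'm) monoid_scheme \<Rightarrow> 'a topology \<Rightarrow> ('g \<Rightarrow> 'a \<Rightarrow> 'a) \<Rightarrow> bool" where
  "distal_action \<Gamma> X \<phi> \<longleftrightarrow>
     (\<forall>x\<in>topspace X. \<forall>y\<in>topspace X. x \<noteq> y \<longrightarrow>
        (prod_topology X X closure_of {(\<phi> \<gamma> x, \<phi> \<gamma> y) | \<gamma>. \<gamma> \<in> carrier \<Gamma>}) \<inter>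
          {(z, z) | z. z \<in> topspace X} = {})"

definition minimal_orbit_closures ::
    "('g, 'm) monoid_scheme \<Rightarrow> 'a topology \<Rightarrow> ('g \<Rightarrow> 'a \<Rightarrow> 'a) \<Rightarrow> bool" where
  "minimal_orbit_closures \<Gamma> X \<phi> \<longleftrightarrow>
     (\<forall>x\<in>topspace X. \<forall>y\<in>topspace X. y \<in> X closure_of orbit \<Gamma> \<phi> x \<longrightarrow>
        X closure_of orbit \<Gamma> \<phi> y = X closure_of orbit \<Gamma> \<phi> x)"

definition equicontinuous_action ::
    "('g, 'm) monoid_scheme \<Rightarrow> ('a, 'n) monoid_scheme \<Rightarrow> 'a topology \<Rightarrow>
       ('g \<Rightarrow> 'a \<Rightarrow> 'a) \<Rightarrow> bool" where
  "equicontinuous_action \<Gamma> G T \<phi> \<longleftrightarrow>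
     neighbourhood_base_at \<one>\<^bsub>G\<^esub> (\<lambda>V. \<forall>\<gamma>\<in>carrier \<Gamma>. \<phi> \<gamma> ` V = V) T"

end

theory Submission
  imports Defs
begin

text \<open>
  Two of the implications hold for every Hausdorff topological group \<open>G\<close>. If orbit closures are minimal, then
  the identity lies in the closure of the orbit of \<open>x\<^sup>-\<^sup>1 y\<close> only for \<open>x = y\<close>, which is distality
  (\<open>minimal_orbit_closures_imp_distal\<close>). If there are small invariant neighbourhoods, then \<open>y\<close> lies in
  the orbit closure of \<open>x\<close> exactly when \<open>x\<close> lies in that of \<open>y\<close>
  (\<open>equicontinuous_imp_minimal_orbit_closures\<close>). The substance is that a distal action is
  equicontinuous: every compact open neighbourhood \<open>U\<close> of the identity must contain an invariant one.

  Distality enters through one fact about compact spaces: a continuous self-map of a compact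
  Hausdorff space whose distinct points are never proximal is surjective (\<open>distal_self_map_surj\<close>,
  from an idempotent in the enveloping semigroup). So whenever an element \<open>g\<close> maps a compact set into
  itself, it maps it onto itself. Applied twice, this shows that some finite intersection
  \<open>U \<inter> g U \<inter> \<dots> \<inter> g\<^sup>n U\<close> is \<open>g\<close>-invariant (\<open>invariant_finite_intersection\<close>).

  To pass from one element to the whole group, ascend the normal series. Suppose that \<open>U\<close> is invariant
  under \<open>N = L\<^sub>i\<^sub>+\<^sub>1\<close>, and let \<open>H = L\<^sub>i\<close>. The stabilisers of compact open sets are open, so on the
  \<open>N\<close>-invariant ones the conditions on \<open>H / N\<close> say two things: \<open>H\<close> is generated by finitely
  many elements together with the stabiliser of \<open>U\<close>, and each conjugacy class of \<open>H\<close> moves \<open>U\<close> to finitely many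
  sets. The latter has two consequences that replace commutativity and the structure theory of
  \<open>FC\<^sup>-\<close>-groups. First, if some power of \<open>f\<close> fixes a point, then some power of \<open>f\<close> fixes each
  translate of it (\<open>periodic_translate\<close>). Second, a conjugation-invariant set that moves a point to
  finitely many places and consists of elements periodic at that point generates a group with
  finite orbit (\<open>finite_orbit_generate\<close>, an orbit version of Dietzmann's lemma). With the Baire category theorem the
  second fact yields an open normal subgroup of \<open>H\<close> under which \<open>U\<close> has a finite orbit
  (\<open>open_normal_subgroup_finite_orbit\<close>). Finitely many further generators
  remain; they are made periodic successively and then absorbed by the second fact again
  (\<open>extend_invariance_to_group\<close>). A finite orbit of sets is always replaced by the intersection of its
  members, which is again a compact open neighbourhood of the identity.
\<close>

section \<open>Distal self-maps of compact spaces\<close>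

text \<open>The classical lemma of Ellis and Numakura: a minimal closed subsemigroup \<open>M\<close> exists by compactness,
  and for any \<open>p \<in> M\<close> minimality forces first \<open>M p = M\<close> and then \<open>{q \<in> M. q p = p} = M\<close>, so that
  \<open>p\<close> is idempotent. Continuity is assumed for \<open>p \<mapsto> p q\<close>, the side on which composition
  in \<open>K\<^sup>K\<close> is continuous for the product topology.\<close>

lemma Ellis_Numakura:
  assumes comp: "compact_space X" and haus: "Hausdorff_space X" and ne: "topspace X \<noteq> {}"
    and closed: "\<And>p q. p \<in> topspace X \<Longrightarrow> q \<in> topspace X \<Longrightarrow> m p q \<in> topspace X"
    and assoc: "\<And>p q r. p \<in> topspace X \<Longrightarrow> q \<in> topspace X \<Longrightarrow> r \<in> topspace X \<Longrightarrow>
                  m (m p q) r = m p (m q r)"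
    and cont: "\<And>q. q \<in> topspace X \<Longrightarrow> continuous_map X X (\<lambda>p. m p q)"
  shows "\<exists>p\<in>topspace X. m p p = p"
proof -
  \<comment> \<open>Zorn's lemma looks for maximal sets, so it is applied to the complements of closed subsemigroups.\<close>
  define \<A> where "\<A> = {U. openin X U \<and> U \<noteq> topspace X \<and>
      (\<forall>p\<in>topspace X - U. \<forall>q\<in>topspace X - U. m p q \<notin> U)}"
  have "\<exists>M\<in>\<A>. \<forall>U\<in>\<A>. M \<subseteq> U \<longrightarrow> U = M"
  proof (rule subset_Zorn_nonempty)
    have "{} \<in> \<A>" using ne unfolding \<A>_def by (intro CollectI conjI openin_empty) blast+
    then show "\<A> \<noteq> {}" by blast
  next
    fix \<C> assume C: "\<C> \<noteq> {}" "subset.chain \<A> \<C>"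
    then have sub: "\<C> \<subseteq> \<A>" by (simp add: subset.chain_def)
    have op: "\<And>U. U \<in> \<C> \<Longrightarrow> openin X U" using sub by (auto simp: \<A>_def)
    have "\<Union>\<C> \<noteq> topspace X"
    proof
      assume "\<Union>\<C> = topspace X"
      then obtain \<F> where F: "finite \<F>" "\<F> \<subseteq> \<C>" "topspace X \<subseteq> \<Union>\<F>"
        using comp op unfolding compact_space_def compactin_def by (metis order_refl)
      have "\<F> \<noteq> {}" using F ne by auto
      moreover have "subset.chain \<A> \<F>"
        using C(2) F(2) unfolding subset_chain_def by (meson order_trans subsetD)
      ultimately have "\<Union>\<F> \<in> \<F>"
        using F(1) by (intro Union_in_chain[of _ \<A>])
      then have *: "\<Union>\<F> \<in> \<A>" using F sub by blast
      then have "\<Union>\<F> \<subseteq> topspace X" by (auto simp: \<A>_def dest: openin_subset)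
      with F * show False by (auto simp: \<A>_def)
    qed
    moreover have "m p q \<notin> \<Union>\<C>"
      if "p \<in> topspace X - \<Union>\<C>" "q \<in> topspace X - \<Union>\<C>" for p q
      using that sub unfolding \<A>_def by blast
    ultimately show "\<Union>\<C> \<in> \<A>" using op by (auto simp: \<A>_def)
  qed
  then obtain U where U: "U \<in> \<A>" and max: "\<And>V. V \<in> \<A> \<Longrightarrow> U \<subseteq> V \<Longrightarrow> V = U" by blast
  define M where "M = topspace X - U"
  have Msub: "M \<subseteq> topspace X" and Mcl: "closedin X M" and Mne: "M \<noteq> {}"
    using U openin_subset[of X U] by (auto simp: M_def \<A>_def)
  have Mm: "m p q \<in> M" if "p \<in> M" "q \<in> M" for p q
    using that U closed unfolding M_def \<A>_def by blast
  have minimal: "N = M"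
    if "closedin X N" "N \<noteq> {}" "N \<subseteq> M" "\<And>p q. p \<in> N \<Longrightarrow> q \<in> N \<Longrightarrow> m p q \<in> N" for N
  proof -
    have NT: "N \<subseteq> topspace X" using that Msub by blast
    then have "topspace X - (topspace X - N) = N" by blast
    then have "topspace X - N \<in> \<A>" using that NT by (auto simp: \<A>_def)
    moreover have "U \<subseteq> topspace X - N"
      using that(3) U openin_subset[of X U] by (auto simp: M_def \<A>_def)
    ultimately have "topspace X - N = U" using max by blast
    then show ?thesis using NT by (auto simp: M_def)
  qed
  obtain p where p: "p \<in> M" using Mne by blast
  then have pT: "p \<in> topspace X" using Msub by blast
  \<comment> \<open>By minimality the left ideal \<open>M p\<close> is all of \<open>M\<close>, so \<open>p\<close> has a left unit in \<open>M\<close>.\<close>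
  have "(\<lambda>q. m q p) ` M = M"
  proof (rule minimal)
    have "compactin X M" using Mcl comp by (simp add: closedin_compact_space)
    then have "compactin X ((\<lambda>q. m q p) ` M)" using cont[OF pT] image_compactin by blast
    then show "closedin X ((\<lambda>q. m q p) ` M)" using haus compactin_imp_closedin by blast
    show "(\<lambda>q. m q p) ` M \<subseteq> M" using Mm p by blast
    fix a b assume "a \<in> (\<lambda>q. m q p) ` M" "b \<in> (\<lambda>q. m q p) ` M"
    then obtain q r where "q \<in> M" "r \<in> M" "a = m q p" "b = m r p" by blast
    then have "m a b = m (m (m q p) r) p" "m (m q p) r \<in> M"
      using assoc[of "m q p" r p] Mm[of q p] Mm[of "m q p" r] p pT subsetD[OF Msub] by auto
    then show "m a b \<in> (\<lambda>q. m q p) ` M" by blast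
  qed (use Mne in blast)
  then obtain u where u: "u \<in> M" "m u p = p" using p by (metis imageE)
  have "{q \<in> M. m q p = p} = M"
  proof (rule minimal)
    have "closedin X {q \<in> topspace X. m q p \<in> {p}}"
      using cont[OF pT] haus pT
      by (intro closedin_continuous_map_preimage) (auto simp: closedin_Hausdorff_sing_eq)
    then have "closedin X (M \<inter> {q \<in> topspace X. m q p \<in> {p}})" using Mcl by blast
    moreover have "M \<inter> {q \<in> topspace X. m q p \<in> {p}} = {q \<in> M. m q p = p}" using Msub by blast
    ultimately show "closedin X {q \<in> M. m q p = p}" by simp
    show "{q \<in> M. m q p = p} \<noteq> {}" using u by blast
    fix a b assume "a \<in> {q \<in> M. m q p = p}" "b \<in> {q \<in> M. m q p = p}"
    then show "m a b \<in> {q \<in> M. m q p = p}" using assoc[of a b p] Msub pT Mm by auto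
  qed blast
  then show ?thesis using p pT by blast
qed

text \<open>The closure in \<open>K\<^sup>K\<close> of the powers \<open>f, f\<^sup>2, \<dots>\<close> is a compact semigroup, hence contains an
  idempotent \<open>p\<close>. It cannot move a point \<open>x\<close>, since \<open>x\<close> and \<open>p x\<close> have the same image under \<open>p\<close> and
  would be proximal. So the identity is a limit of powers \<open>f\<^sup>k\<close> with \<open>k \<ge> 1\<close>, and each \<open>x\<close> is a limit
  of points of the closed set \<open>f ` K\<close>. This is how distality turns an inclusion
  \<open>f ` K \<subseteq> K\<close> into an equality.\<close>

lemma distal_self_map_surj:
  assumes haus: "Hausdorff_space T" and K: "compactin T K"
    and f: "continuous_map (subtopology T K) (subtopology T K) f"
    and distal: "\<And>x y. x \<in> K \<Longrightarrow> y \<in> K \<Longrightarrow> x \<noteq> y \<Longrightarrow>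
      (prod_topology T T closure_of {((f ^^ k) x, (f ^^ k) y) | k. True}) \<inter> {(z, z) | z. z \<in> topspace T} = {}"
  shows "f ` K = K"
proof (cases "K = {}")
  case False
  let ?K = "subtopology T K"
  have KT: "K \<subseteq> topspace T" using K by (rule compactin_subset_topspace)
  have tK: "topspace ?K = K" using KT by auto
  have fK: "f x \<in> K" if "x \<in> K" for x using f that tK by (auto simp: continuous_map_def)
  define P where "P = product_topology (\<lambda>_. ?K) K"
  have tP: "topspace P = K \<rightarrow>\<^sub>E K" using tK by (simp add: P_def)
  \<comment> \<open>The exponent is shifted by one because the identity must not be among the powers.\<close>
  define F where "F k = f ^^ Suc k" for k
  define it where "it k = restrict (F k) K" for k
  have FK: "F k x \<in> K" if "x \<in> K" for x k
    unfolding F_def using that fK by (induction k) auto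
  have contF: "continuous_map ?K ?K (F k)" for k
  proof (induction k)
    case 0
    have "F 0 = f" by (auto simp: F_def)
    then show ?case using f by simp
  next
    case (Suc k)
    have "F (Suc k) = f \<circ> F k" by (simp add: F_def)
    then show ?case using continuous_map_compose[OF Suc f] by metis
  qed
  have FF: "F j (F k x) = F (j + Suc k) x" for j k x
    unfolding F_def by (metis add_Suc funpow_add o_apply)
  have fF: "F k x \<in> f ` K" if "x \<in> K" for k x
  proof (cases k)
    case 0
    then show ?thesis using that by (auto simp: F_def)
  next
    case (Suc j)
    then have "F k x = f (F j x)" by (simp add: F_def)
    then show ?thesis using FK[OF that] by blast
  qed
  have itP: "it k \<in> topspace P" for k using FK by (auto simp: tP it_def)
  define S where "S = P closure_of range it"
  have ST: "S \<subseteq> topspace P" by (simp add: S_def closure_of_subset_topspace)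
  have SK: "p x \<in> K" if "p \<in> S" "x \<in> K" for p x using that ST tP by auto
  have itS: "it k \<in> S" for k unfolding S_def using closure_of_subset[of "range it" P] itP by blast
  have closedS: "closedin P S" by (simp add: S_def)
  have proj: "continuous_map P ?K (\<lambda>p. p x)" if "x \<in> K" for x
    unfolding P_def using that by (rule continuous_map_product_projection)
  have right: "continuous_map P P (\<lambda>p. compose K p q)" if "q \<in> S" for q
    unfolding P_def continuous_map_componentwise
    using proj SK[OF that] by (auto simp: compose_def P_def)
  have left: "continuous_map P P (\<lambda>q. compose K (it k) q)" for k
  proof -
    have "continuous_map P ?K (\<lambda>q. compose K (it k) q x)" if x: "x \<in> K" for x
    proof (rule continuous_map_eq)
      show "continuous_map P ?K (\<lambda>q. F k (q x))"
        using continuous_map_compose[OF proj[OF x] contF] by (simp add: o_def)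
      show "F k (q x) = compose K (it k) q x" if "q \<in> topspace P" for q
        using that x by (auto simp: compose_def it_def tP)
    qed
    then show ?thesis
      unfolding P_def continuous_map_componentwise by (auto simp: compose_def)
  qed
  have itit: "compose K (it j) (it k) = it (j + Suc k)" for j k
    by (rule ext) (simp add: compose_def it_def FK FF)
  have compS: "compose K p q \<in> S" if "p \<in> S" "q \<in> S" for p q
  proof -
    have 1: "compose K (it k) r \<in> S" if "r \<in> S" for r k
    proof -
      have "compose K (it k) ` (P closure_of range it) \<subseteq> P closure_of (compose K (it k) ` range it)"
        using left by (rule continuous_map_image_closure_subset)
      also have "\<dots> \<subseteq> S" unfolding S_def by (rule closure_of_mono) (auto simp: itit)
      finally show ?thesis using that S_def by blast
    qed
    have "(\<lambda>p. compose K p q) ` (P closure_of range it) \<subseteq> P closure_of ((\<lambda>p. compose K p q) ` range it)"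
      using right[OF \<open>q \<in> S\<close>] by (rule continuous_map_image_closure_subset)
    also have "\<dots> \<subseteq> S" using 1[OF \<open>q \<in> S\<close>] closedS by (intro closure_of_minimal) auto
    finally show ?thesis using that S_def by blast
  qed
  let ?S = "subtopology P S"
  have tS: "topspace ?S = S" using ST by auto
  have compP: "compact_space P"
    unfolding P_def compact_space_product_topology using K by (simp add: compact_space_subtopology)
  have "\<exists>p\<in>topspace ?S. compose K p p = p"
  proof (rule Ellis_Numakura[where m = "compose K"])
    show "compact_space ?S"
      using compP closedS by (simp add: closedin_compact_space compact_space_subtopology)
    have "Hausdorff_space P" unfolding P_def
      using haus by (simp add: Hausdorff_space_product_topology Hausdorff_space_subtopology)
    then show "Hausdorff_space ?S" by (rule Hausdorff_space_subtopology)
    show "topspace ?S \<noteq> {}" using tS itS by auto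
    show "compose K p q \<in> topspace ?S" if "p \<in> topspace ?S" "q \<in> topspace ?S" for p q
      using that compS tS by simp
    show "compose K (compose K p q) r = compose K p (compose K q r)"
      if "p \<in> topspace ?S" "q \<in> topspace ?S" "r \<in> topspace ?S" for p q r
      using that tS SK by (intro ext) (auto simp: compose_def)
    show "continuous_map ?S ?S (\<lambda>p. compose K p q)" if "q \<in> topspace ?S" for q
      using right[of q] that tS compS
      by (auto simp: continuous_map_in_subtopology intro!: continuous_map_from_subtopology)
  qed
  then obtain p where pS: "p \<in> S" and pp: "compose K p p = p" using tS by auto
  \<comment> \<open>The idempotent identifies \<open>x\<close> with \<open>p x\<close>, so these two points are proximal.\<close>
  have pid: "p x = x" if x: "x \<in> K" for x
  proof (rule ccontr)
    assume ne: "p x \<noteq> x"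
    have px: "p x \<in> K" using SK pS x by blast
    have ppx: "p (p x) = p x" using pp x by (metis compose_eq)
    have toT: "continuous_map P T (\<lambda>q. q y)" if "y \<in> K" for y
      using proj[OF that] continuous_map_in_subtopology by blast
    have "continuous_map P (prod_topology T T) (\<lambda>q. (q x, q (p x)))"
      using toT x px by (auto simp: continuous_map_pairedI)
    then have "(p x, p (p x)) \<in> prod_topology T T closure_of ((\<lambda>q. (q x, q (p x))) ` range it)"
      using continuous_map_image_closure_subset pS S_def by blast
    also have "\<dots> \<subseteq> prod_topology T T closure_of {((f ^^ k) x, (f ^^ k) (p x)) | k. True}"
      using x px by (intro closure_of_mono) (auto simp: it_def F_def simp del: funpow.simps)
    finally show False using distal[OF x px] ne ppx KT px by auto
  qed
  show ?thesis
  proof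
    show "f ` K \<subseteq> K" using fK by blast
    show "K \<subseteq> f ` K"
    proof
      fix x assume x: "x \<in> K"
      have "continuous_map P T (\<lambda>q. q x)" using proj[OF x] continuous_map_in_subtopology by blast
      then have "p x \<in> T closure_of ((\<lambda>q. q x) ` range it)"
        using continuous_map_image_closure_subset pS S_def by blast
      also have "\<dots> \<subseteq> f ` K"
      proof (rule closure_of_minimal)
        show "(\<lambda>q. q x) ` range it \<subseteq> f ` K" using x fK FK fF by (auto simp: it_def)
        have "compactin ?K K" using K by (simp add: compactin_subtopology)
        then have "compactin ?K (f ` K)" using f image_compactin by blast
        then have "compactin T (f ` K)" by (simp add: compactin_subtopology)
        then show "closedin T (f ` K)" using haus compactin_imp_closedin by blast
      qed
      finally show "x \<in> f ` K" using pid[OF x] by simp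
    qed
  qed
qed simp

section \<open>Periodic points and an orbit version of Dietzmann's lemma\<close>

context group
begin

lemma conjugacy_class_carrier: "g \<in> carrier G \<Longrightarrow> conjugacy_class G g \<subseteq> carrier G"
  by (auto simp: conjugacy_class_def)

lemma conjugate_conjugate:
  assumes "a \<in> carrier G" "b \<in> carrier G" "g \<in> carrier G"
  shows "a \<otimes> (b \<otimes> g \<otimes> inv b) \<otimes> inv a = (a \<otimes> b) \<otimes> g \<otimes> inv (a \<otimes> b)"
  using assms by (simp add: inv_mult_group m_assoc)

lemma conjugacy_class_conj_closed:
  assumes "g \<in> carrier G" "h \<in> conjugacy_class G g" "a \<in> carrier G"
  shows "a \<otimes> h \<otimes> inv a \<in> conjugacy_class G g"
proof -
  obtain b where "b \<in> carrier G" "h = b \<otimes> g \<otimes> inv b"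
    using assms by (auto simp: conjugacy_class_def)
  then show ?thesis
    using assms conjugate_conjugate[of a b g] by (auto simp: conjugacy_class_def)
qed

lemma self_in_conjugacy_class: "g \<in> carrier G \<Longrightarrow> g \<in> conjugacy_class G g"
  unfolding conjugacy_class_def by (intro CollectI exI[of _ \<one>]) simp

lemma conj_pow:
  assumes "f \<in> carrier G" "g \<in> carrier G"
  shows "(g \<otimes> f \<otimes> inv g) [^] (n::nat) = g \<otimes> f [^] n \<otimes> inv g"
proof (induction n)
  case (Suc n)
  have "(g \<otimes> f \<otimes> inv g) [^] Suc n = (g \<otimes> f [^] n \<otimes> inv g) \<otimes> (g \<otimes> (f \<otimes> inv g))"
    using Suc assms by (simp add: m_assoc)
  also have "\<dots> = (g \<otimes> f [^] n) \<otimes> (inv g \<otimes> (g \<otimes> (f \<otimes> inv g)))"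
    using assms by (simp only: m_assoc m_closed inv_closed nat_pow_closed)
  also have "inv g \<otimes> (g \<otimes> (f \<otimes> inv g)) = f \<otimes> inv g"
    using assms by (simp add: m_assoc[symmetric])
  finally show ?case using assms by (simp add: m_assoc)
qed (use assms in auto)

end

text \<open>In the application the points are subsets of a topological space, moved by taking images. Maps on
  \<open>Pow (topspace T)\<close> given by images are not extensional, so this locale asks for the action laws on
  \<open>E\<close> only instead of a homomorphism into \<open>BijGroup E\<close>.\<close>

locale acting_group = group \<Gamma> for \<Gamma> (structure) +
  fixes E :: "'x set" and act :: "'g \<Rightarrow> 'x \<Rightarrow> 'x"
  assumes act_closed: "g \<in> carrier \<Gamma> \<Longrightarrow> x \<in> E \<Longrightarrow> act g x \<in> E"
    and act_one: "x \<in> E \<Longrightarrow> act \<one> x = x"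
    and act_mult: "g \<in> carrier \<Gamma> \<Longrightarrow> h \<in> carrier \<Gamma> \<Longrightarrow> x \<in> E \<Longrightarrow> act (g \<otimes> h) x = act g (act h x)"
begin

lemma act_inv:
  assumes "g \<in> carrier \<Gamma>" "x \<in> E"
  shows "act (inv g) (act g x) = x" "act g (act (inv g) x) = x"
  using act_mult[of "inv g" g x] act_mult[of g "inv g" x] act_one assms by auto

lemma act_inj:
  assumes "g \<in> carrier \<Gamma>" "x \<in> E" "y \<in> E" "act g x = act g y"
  shows "x = y"
  using act_inv(1) assms by metis

lemma act_conj:
  assumes "g \<in> carrier \<Gamma>" "h \<in> carrier \<Gamma>" "x \<in> E"
  shows "act g (act h x) = act (g \<otimes> h \<otimes> inv g) (act g x)"
proof -
  have "g \<otimes> h \<otimes> inv g \<otimes> g = g \<otimes> h" using assms by (simp add: m_assoc)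
  then show ?thesis
    using assms act_mult[of "g \<otimes> h \<otimes> inv g" g x] act_mult[of g h x] by simp
qed

lemma stabilizer_subgroup:
  assumes x: "x \<in> E"
  shows "subgroup (stabilizer \<Gamma> act x) \<Gamma>"
proof (rule subgroupI)
  show "stabilizer \<Gamma> act x \<noteq> {}"
    using act_one[OF x] by (auto simp: stabilizer_def)
  show "inv a \<in> stabilizer \<Gamma> act x" if "a \<in> stabilizer \<Gamma> act x" for a
    using that act_inv(1)[of a x] x by (simp add: stabilizer_def)
  show "a \<otimes> b \<in> stabilizer \<Gamma> act x"
    if "a \<in> stabilizer \<Gamma> act x" "b \<in> stabilizer \<Gamma> act x" for a b
    using that x by (simp add: stabilizer_def act_mult)
qed (auto simp: stabilizer_def)

lemma normal_fixes_translate: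
  assumes N: "N \<lhd> \<Gamma>" and x: "x \<in> E" "N \<subseteq> stabilizer \<Gamma> act x" and g: "g \<in> carrier \<Gamma>"
  shows "N \<subseteq> stabilizer \<Gamma> act (act g x)"
proof
  fix m assume m: "m \<in> N"
  then have mc: "m \<in> carrier \<Gamma>" using x(2) by (auto simp: stabilizer_def)
  have c: "inv g \<otimes> m \<otimes> g \<in> carrier \<Gamma>" "act (inv g \<otimes> m \<otimes> g) x = x"
    using normal.inv_op_closed1[OF N g m] x(2) by (auto simp: stabilizer_def)
  have "m \<otimes> g = g \<otimes> (inv g \<otimes> m \<otimes> g)" using mc g by (simp add: m_assoc[symmetric])
  then have "act m (act g x) = act g (act (inv g \<otimes> m \<otimes> g) x)"
    using act_mult[OF mc g x(1)] act_mult[OF g c(1) x(1)] by simp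
  then show "m \<in> stabilizer \<Gamma> act (act g x)" using c(2) mc by (simp add: stabilizer_def)
qed

lemma act_pow_fixed:
  assumes "g \<in> carrier \<Gamma>" "x \<in> E" "act g x = x"
  shows "act (g [^] (n::nat)) x = x"
  using assms by (induction n) (auto simp: act_one act_mult)

definition periodic :: "'g \<Rightarrow> 'x \<Rightarrow> bool" where
  "periodic g x \<longleftrightarrow> (\<exists>k>0. act (g [^] (k::nat)) x = x)"

lemma periodicI: "g \<in> carrier \<Gamma> \<Longrightarrow> act g x = x \<Longrightarrow> periodic g x"
  unfolding periodic_def by (intro exI[of _ 1]) simp

lemma periodic_common_power:
  assumes f: "f \<in> carrier \<Gamma>" and I: "finite I" "\<And>i. i \<in> I \<Longrightarrow> X i \<in> E \<and> periodic f (X i)"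
  shows "\<exists>k>0. \<forall>i\<in>I. act (f [^] (k::nat)) (X i) = X i"
  using I
proof (induction rule: finite_induct)
  case empty
  then show ?case by auto
next
  case (insert j J)
  then obtain k where k: "k > 0" "\<forall>i\<in>J. act (f [^] (k::nat)) (X i) = X i" by auto
  have "periodic f (X j)" using insert.prems by blast
  then obtain l where l: "l > 0" "act (f [^] (l::nat)) (X j) = X j" by (auto simp: periodic_def)
  have "act (f [^] (k * l)) (X i) = X i" if "i \<in> J" for i
    using act_pow_fixed[of "f [^] k" "X i" l] f insert.prems k that by (simp add: nat_pow_pow)
  moreover have "act (f [^] (k * l)) (X j) = X j"
    using act_pow_fixed[of "f [^] l" "X j" k] f insert.prems l by (simp add: nat_pow_pow mult.commute)
  ultimately show ?case using k(1) l(1) by (intro exI[of _ "k * l"]) auto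
qed

definition class_orbit :: "'g \<Rightarrow> 'x \<Rightarrow> 'x set" where
  "class_orbit g x = (\<lambda>h. act h x) ` conjugacy_class \<Gamma> g"

lemma class_orbit_translate:
  assumes "g \<in> carrier \<Gamma>" "h \<in> carrier \<Gamma>" "x \<in> E"
  shows "class_orbit g (act h x) = act h ` class_orbit g x"
proof
  show "act h ` class_orbit g x \<subseteq> class_orbit g (act h x)"
  proof
    fix y assume "y \<in> act h ` class_orbit g x"
    then obtain c where c: "c \<in> conjugacy_class \<Gamma> g" "y = act h (act c x)"
      by (auto simp: class_orbit_def)
    have "c \<in> carrier \<Gamma>" using c conjugacy_class_carrier assms by blast
    then have "y = act (h \<otimes> c \<otimes> inv h) (act h x)" using c act_conj assms by blast
    moreover have "h \<otimes> c \<otimes> inv h \<in> conjugacy_class \<Gamma> g"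
      using conjugacy_class_conj_closed c assms by blast
    ultimately show "y \<in> class_orbit g (act h x)" by (auto simp: class_orbit_def)
  qed
  show "class_orbit g (act h x) \<subseteq> act h ` class_orbit g x"
  proof
    fix y assume "y \<in> class_orbit g (act h x)"
    then obtain c where c: "c \<in> conjugacy_class \<Gamma> g" "y = act c (act h x)"
      by (auto simp: class_orbit_def)
    let ?c = "inv h \<otimes> c \<otimes> inv (inv h)"
    have "c \<in> carrier \<Gamma>" using c conjugacy_class_carrier assms by blast
    then have "h \<otimes> ?c = c \<otimes> h" "?c \<in> carrier \<Gamma>"
      using assms by (simp_all add: m_assoc[symmetric])
    then have "y = act h (act ?c x)"
      using c \<open>c \<in> carrier \<Gamma>\<close> assms act_mult[of h ?c x] act_mult[of c h x] by simp
    moreover have "?c \<in> conjugacy_class \<Gamma> g" using conjugacy_class_conj_closed c assms by blast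
    ultimately show "y \<in> act h ` class_orbit g x" by (auto simp: class_orbit_def)
  qed
qed

text \<open>If \<open>f\<^sup>k\<close> fixes \<open>x\<close>, then the orbit of \<open>g x\<close> under \<open>f\<^sup>k\<close> consists of images of \<open>x\<close> under conjugates of
  \<open>g\<close>. So when conjugates of \<open>g\<close> move \<open>x\<close> to finitely many places only, periodicity passes from
  \<open>x\<close> to \<open>g x\<close>. It replaces the commutation of \<open>f\<close> and \<open>g\<close> that one would use for abelian groups.\<close>

lemma periodic_translate:
  assumes f: "f \<in> carrier \<Gamma>" and g: "g \<in> carrier \<Gamma>" and x: "x \<in> E"
    and fin: "finite (class_orbit g x)" and per: "periodic f x"
  shows "periodic f (act g x)"
proof -
  obtain k where k: "k > 0" "act (f [^] (k::nat)) x = x" using per by (auto simp: periodic_def)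
  define h where "h = f [^] k"
  have h: "h \<in> carrier \<Gamma>" "act h x = x" using f k by (auto simp: h_def)
  have gx: "act g x \<in> E" using act_closed g x by blast
  \<comment> \<open>Since \<open>h\<close> fixes \<open>x\<close>, the power \<open>h\<^sup>j\<close> moves \<open>g x\<close> to the image of \<open>x\<close> under a conjugate of \<open>g\<close>.\<close>
  have "act (h [^] j) (act g x) \<in> class_orbit g x" for j :: nat
  proof -
    have "act (h [^] j) (act g x) = act (h [^] j \<otimes> g \<otimes> inv (h [^] j)) x"
      using act_conj[of "h [^] j" g x] act_pow_fixed[OF h(1) x h(2)] h g x by simp
    then show ?thesis
      using h by (auto simp: class_orbit_def conjugacy_class_def)
  qed
  then have "range (\<lambda>j::nat. act (h [^] j) (act g x)) \<subseteq> class_orbit g x" by blast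
  then have "finite (range (\<lambda>j::nat. act (h [^] j) (act g x)))" using fin finite_subset by blast
  then have "\<not> inj (\<lambda>j::nat. act (h [^] j) (act g x))" using finite_imageD infinite_UNIV_nat by blast
  then obtain i j where ij: "i < j" "act (h [^] (i::nat)) (act g x) = act (h [^] j) (act g x)"
    unfolding inj_def by (metis nat_neq_iff)
  define d where "d = j - i"
  have "j = i + d" "d > 0" using ij by (auto simp: d_def)
  then have "act (h [^] i) (act g x) = act (h [^] i) (act (h [^] d) (act g x))"
    using ij act_mult[of "h [^] i" "h [^] d" "act g x"] gx h by (simp add: nat_pow_mult)
  then have "act g x = act (h [^] d) (act g x)"
    using act_inj[of "h [^] i"] gx h act_closed by simp
  then have "act (f [^] (k * d)) (act g x) = act g x" using f by (simp add: h_def nat_pow_pow)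
  then show ?thesis
    unfolding periodic_def using k(1) \<open>d > 0\<close> by (intro exI[of _ "k * d"]) simp
qed

lemma periodic_conj:
  assumes f: "f \<in> carrier \<Gamma>" and g: "g \<in> carrier \<Gamma>" and x: "x \<in> E"
    and fin: "finite (class_orbit (inv g) x)" and per: "periodic f x"
  shows "periodic (g \<otimes> f \<otimes> inv g) x"
proof -
  obtain k where k: "k > 0" "act (f [^] (k::nat)) (act (inv g) x) = act (inv g) x"
    using periodic_translate[of f "inv g" x] assms by (auto simp: periodic_def)
  then have "act ((g \<otimes> f \<otimes> inv g) [^] k) x = x"
    using assms act_closed by (simp add: conj_pow act_mult act_inv)
  then show ?thesis using k(1) by (auto simp: periodic_def)
qed

definition word :: "'g list \<Rightarrow> 'x \<Rightarrow> 'x" where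
  "word ws x = foldr act ws x"

lemma word_simps [simp]:
  "word [] x = x" "word (d # ws) x = act d (word ws x)"
  by (simp_all add: word_def)

lemma word_closed: "set ws \<subseteq> carrier \<Gamma> \<Longrightarrow> x \<in> E \<Longrightarrow> word ws x \<in> E"
  by (induction ws) (auto simp: act_closed)

lemma word_conj:
  assumes "g \<in> carrier \<Gamma>" "set ws \<subseteq> carrier \<Gamma>" "x \<in> E"
  shows "act g (word ws x) = word (map (\<lambda>d. g \<otimes> d \<otimes> inv g) ws) (act g x)"
  using assms by (induction ws) (auto simp: act_conj word_closed)

end

text \<open>The setting of a version of Dietzmann's lemma (a finite conjugation-invariant set of torsion elements
  generates a finite group) in which finiteness is only observed at one point \<open>x\<close>: the set \<open>D\<close> may be
  infinite, but it moves \<open>x\<close> to finitely many places and its elements are periodic, rather than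
  torsion, at \<open>x\<close>.\<close>

locale conjugation_stable_set = acting_group +
  fixes D x
  assumes D_carrier: "D \<subseteq> carrier \<Gamma>" and x_in: "x \<in> E"
    and D_conj: "g \<in> carrier \<Gamma> \<Longrightarrow> d \<in> D \<Longrightarrow> g \<otimes> d \<otimes> inv g \<in> D"
    and D_finite: "finite ((\<lambda>d. act d x) ` D)"
    and D_periodic: "d \<in> D \<Longrightarrow> periodic d x"
begin

text \<open>Words in \<open>D\<close> can be spelled in a finite alphabet as far as their effect on \<open>x\<close> is concerned: the
  leading letter is moved next to \<open>x\<close> by conjugating the others, replaced there by its representative, and moved
  back.\<close>

lemma word_over_representatives:
  assumes F: "F \<subseteq> D" "(\<lambda>d. act d x) ` D = (\<lambda>d. act d x) ` F" and "set ws \<subseteq> D"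
  shows "\<exists>fs. set fs \<subseteq> F \<and> length fs = length ws \<and> word ws x = word fs x"
  using assms(3)
proof (induction "length ws" arbitrary: ws)
  case (Suc n)
  then obtain d ds where ws: "ws = d # ds" by (cases ws) auto
  obtain f where f: "f \<in> F" "act d x = act f x" using F(2) Suc.prems ws by force
  have car: "d \<in> carrier \<Gamma>" "f \<in> carrier \<Gamma>" "set ds \<subseteq> carrier \<Gamma>"
    using Suc.prems ws f F D_carrier by auto
  let ?cs = "map (\<lambda>c. d \<otimes> c \<otimes> inv d) ds"
  let ?es = "map (\<lambda>c. inv f \<otimes> c \<otimes> inv (inv f)) ?cs"
  have cs: "set ?cs \<subseteq> D" using D_conj car Suc.prems ws by auto
  have es: "set ?es \<subseteq> D" using D_conj[of "inv f"] car cs by auto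
  have "word ws x = word ?cs (act f x)" using word_conj car f x_in ws by simp
  also have "\<dots> = act f (act (inv f) (word ?cs (act f x)))"
    using act_inv(2) car cs D_carrier x_in by (metis act_closed subset_trans word_closed)
  also have "act (inv f) (word ?cs (act f x)) = word ?es x"
    using word_conj[of "inv f" ?cs "act f x", OF _ order_trans[OF cs D_carrier]] car x_in
    by (simp add: act_closed act_inv(1))
  finally have "word ws x = act f (word ?es x)" .
  moreover obtain fs where "set fs \<subseteq> F" "length fs = length ?es" "word ?es x = word fs x"
    using Suc.hyps(1)[of ?es] Suc.hyps(2) ws es by auto
  ultimately show ?case using f ws by (intro exI[of _ "f # fs"]) auto
qed (use F in auto)

text \<open>Letters can be collected at the right end, where \<open>d\<^sup>k\<close> meets \<open>x\<close> directly and disappears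
  when it fixes \<open>x\<close>. This shortens a long word.\<close>

lemma collect_letter:
  assumes "set ws \<subseteq> D" "k \<le> count_list ws d"
  shows "\<exists>us. set us \<subseteq> D \<and> length us + k = length ws \<and> word ws x = word us (act (d [^] k) x)"
  using assms
proof (induction ws arbitrary: k)
  case Nil
  then show ?case using act_one x_in by auto
next
  case (Cons a ws)
  show ?case
  proof (cases "a = d \<and> k > 0")
    case True
    then obtain j where j: "k = Suc j" "j \<le> count_list ws d" using Cons.prems by (cases k) auto
    obtain us where us: "set us \<subseteq> D" "length us + j = length ws" "word ws x = word us (act (d [^] j) x)"
      using Cons.IH[of j] Cons.prems j by auto
    have d: "d \<in> carrier \<Gamma>" using Cons.prems True D_carrier by auto
    let ?vs = "map (\<lambda>c. d \<otimes> c \<otimes> inv d) us"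
    have "word (a # ws) x = word ?vs (act d (act (d [^] j) x))"
      using us True d word_conj[of d us] D_carrier x_in act_closed by auto
    also have "act d (act (d [^] j) x) = act (d [^] k) x"
      using d x_in j act_mult[of d "d [^] j" x] by (simp add: nat_pow_comm[of d 1 j, simplified])
    finally show ?thesis
      using us j D_conj d by (intro exI[of _ ?vs]) auto
  next
    case False
    then have "k \<le> count_list ws d" using Cons.prems by (auto split: if_splits)
    then obtain us where "set us \<subseteq> D" "length us + k = length ws" "word ws x = word us (act (d [^] k) x)"
      using Cons.IH[of k] Cons.prems by auto
    then show ?thesis using Cons.prems by (intro exI[of _ "a # us"]) auto
  qed
qed

text \<open>A word in the finite alphabet that is longer than the sum of the periods contains some letter at
  least as often as its period, and so can be shortened. Hence words of bounded length already
  produce the whole orbit.\<close>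

theorem finite_orbit_generate: "finite ((\<lambda>g. act g x) ` generate \<Gamma> D)"
proof -
  obtain F where F: "F \<subseteq> D" "finite F" "(\<lambda>d. act d x) ` D = (\<lambda>d. act d x) ` F"
    using finite_subset_image[OF D_finite] by (metis subset_refl)
  have "\<forall>f\<in>F. \<exists>k>0. act (f [^] (k::nat)) x = x"
    using D_periodic F(1) by (auto simp: periodic_def)
  then obtain k where k: "\<And>f. f \<in> F \<Longrightarrow> k f > 0 \<and> act (f [^] (k f :: nat)) x = x" by metis
  define K where "K = (\<Sum>f\<in>F. k f)"
  have short: "\<exists>fs. set fs \<subseteq> F \<and> length fs \<le> K \<and> word ws x = word fs x" if "set ws \<subseteq> D" for ws
    using that
  proof (induction "length ws" arbitrary: ws rule: less_induct)
    case less
    obtain fs where fs: "set fs \<subseteq> F" "length fs = length ws" "word ws x = word fs x"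
      using word_over_representatives[OF F(1,3) less.prems] by blast
    show ?case
    proof (cases "length fs \<le> K")
      case False
      have "\<exists>f\<in>F. k f \<le> count_list fs f"
      proof (rule ccontr)
        assume "\<not> ?thesis"
        then have "(\<Sum>f\<in>F. count_list fs f) \<le> K"
          unfolding K_def by (intro sum_mono) (metis linorder_not_le less_imp_le)
        then show False using False sum_count_set[OF fs(1) F(2)] by simp
      qed
      then obtain f where f: "f \<in> F" "k f \<le> count_list fs f" by blast
      obtain us where us: "set us \<subseteq> D" "length us + k f = length fs" "word fs x = word us (act (f [^] k f) x)"
        using collect_letter[OF _ f(2)] fs(1) F(1) by blast
      have "length us < length ws" using us(2) fs(2) k[OF f(1)] by linarith
      moreover have "word fs x = word us x" using us(3) k[OF f(1)] by simp
      ultimately show ?thesis using less.hyps us(1) fs(3) by metis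
    qed (use fs in blast)
  qed
  define A where "A = (\<lambda>ws. word ws x) ` {ws. set ws \<subseteq> D}"
  have "A \<subseteq> (\<lambda>fs. word fs x) ` {fs. set fs \<subseteq> F \<and> length fs \<le> K}"
    unfolding A_def using short by blast
  then have finA: "finite A" using finite_lists_length_le[OF F(2)] finite_subset by blast
  have AE: "A \<subseteq> E" unfolding A_def using word_closed D_carrier x_in by blast
  have DA: "act d ` A = A" if d: "d \<in> D" for d
  proof (rule card_subset_eq[OF finA])
    show "act d ` A \<subseteq> A"
    proof
      fix y assume "y \<in> act d ` A"
      then obtain ws where "set ws \<subseteq> D" "y = act d (word ws x)" by (auto simp: A_def)
      then have "set (d # ws) \<subseteq> D" "y = word (d # ws) x" using d by auto
      then show "y \<in> A" unfolding A_def by blast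
    qed
    have "inj_on (act d) A" using act_inj d D_carrier AE by (meson inj_onI subsetD)
    then show "card (act d ` A) = card A" by (rule card_image)
  qed
  have "act g ` A \<subseteq> A" if "g \<in> generate \<Gamma> D" for g
    using that
  proof (induction rule: generate.induct)
    case one
    then show ?case using act_one AE by auto
  next
    case (incl h)
    then show ?case using DA by blast
  next
    case (inv h)
    then show ?case using DA[OF inv] act_inv(1) D_carrier AE by (smt (verit) image_iff image_subset_iff subsetD)
  next
    case (eng h1 h2)
    have "h1 \<in> carrier \<Gamma>" "h2 \<in> carrier \<Gamma>" using eng generate_incl[OF D_carrier] by auto
    then show ?case using eng act_mult AE by (auto simp: subset_eq)
  qed
  moreover have "x \<in> A"
    unfolding A_def by (rule image_eqI[of _ _ "[]"]) auto
  ultimately have "(\<lambda>g. act g x) ` generate \<Gamma> D \<subseteq> A" by blast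
  then show ?thesis using finA finite_subset by blast
qed

end

section \<open>Open normal subgroups with finite orbits\<close>

context topological_group
begin

lemma continuous_map_mult:
  assumes "continuous_map X T f" "continuous_map X T h"
  shows "continuous_map X T (\<lambda>x. f x \<otimes> h x)"
proof -
  have "continuous_map X (prod_topology T T) (\<lambda>x. (f x, h x))"
    using assms by (simp add: continuous_map_pairedI)
  from continuous_map_compose[OF this continuous_mult] show ?thesis by (simp add: o_def)
qed

lemma continuous_map_const_mult:
  assumes "a \<in> carrier G" "continuous_map X T f"
  shows "continuous_map X T (\<lambda>x. a \<otimes> f x)"
  using assms topspace_eq_carrier by (intro continuous_map_mult) auto

lemma continuous_map_mult_const:
  assumes "a \<in> carrier G" "continuous_map X T f"
  shows "continuous_map X T (\<lambda>x. f x \<otimes> a)"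
  using assms topspace_eq_carrier by (intro continuous_map_mult) auto

lemma open_subgroupI:
  assumes H: "subgroup H G" and U: "openin T U" "\<one> \<in> U" "U \<subseteq> H"
  shows "openin T H"
proof (subst openin_subopen, intro ballI)
  fix h assume h: "h \<in> H"
  then have hc: "h \<in> carrier G" using subgroup.subset[OF H] by blast
  have "continuous_map T T (\<lambda>x. inv h \<otimes> x)"
    using hc continuous_map_const_mult[of "inv h" T "\<lambda>x. x"] by simp
  then have "openin T {x \<in> topspace T. inv h \<otimes> x \<in> U}"
    using U(1) openin_continuous_map_preimage by blast
  moreover have "{x \<in> topspace T. inv h \<otimes> x \<in> U} \<subseteq> H"
  proof
    fix x assume x: "x \<in> {x \<in> topspace T. inv h \<otimes> x \<in> U}"
    then have "h \<otimes> (inv h \<otimes> x) \<in> H" using U(3) h subgroup.m_closed[OF H] by blast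
    then show "x \<in> H" using x hc topspace_eq_carrier by (simp add: m_assoc[symmetric])
  qed
  ultimately show "\<exists>V. openin T V \<and> h \<in> V \<and> V \<subseteq> H"
    using U(2) hc topspace_eq_carrier by (intro exI[of _ "{x \<in> topspace T. inv h \<otimes> x \<in> U}"]) auto
qed

lemma openin_lcoset:
  assumes U: "openin T U" and h: "h \<in> carrier G"
  shows "openin T (h <# U)"
proof -
  have UG: "U \<subseteq> carrier G" using U openin_subset topspace_eq_carrier by blast
  have "continuous_map T T (\<lambda>x. inv h \<otimes> x)"
    using h continuous_map_const_mult[of "inv h" T "\<lambda>x. x"] by simp
  then have "openin T {x \<in> topspace T. inv h \<otimes> x \<in> U}"
    using U openin_continuous_map_preimage by blast
  moreover have "{x \<in> topspace T. inv h \<otimes> x \<in> U} = h <# U"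
  proof
    show "h <# U \<subseteq> {x \<in> topspace T. inv h \<otimes> x \<in> U}"
      using UG h topspace_eq_carrier by (auto simp: l_coset_def m_assoc[symmetric])
    show "{x \<in> topspace T. inv h \<otimes> x \<in> U} \<subseteq> h <# U"
    proof
      fix x assume x: "x \<in> {x \<in> topspace T. inv h \<otimes> x \<in> U}"
      then have "x = h \<otimes> (inv h \<otimes> x)" using h topspace_eq_carrier by (simp add: m_assoc[symmetric])
      then show "x \<in> h <# U" using x by (auto simp: l_coset_def)
    qed
  qed
  ultimately show ?thesis by simp
qed

end

locale topological_acting_group = acting_group \<Gamma> E act + topological_group \<Gamma> S
  for \<Gamma> :: "('g, 'm) monoid_scheme" (structure) and E :: "'x set" and act and S
begin

text \<open>The map \<open>h \<mapsto> g h g\<^sup>-\<^sup>1 x\<close> is locally constant: it does not change when \<open>h\<close> is multiplied on the right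
  by an element of the open subgroup \<open>g\<^sup>-\<^sup>1 W g\<close>, where \<open>W\<close> is the stabiliser of \<open>x\<close>.\<close>

lemma open_conjugate_preimage:
  assumes x: "x \<in> E" and op: "openin S (stabilizer \<Gamma> act x)" and g: "g \<in> carrier \<Gamma>"
  shows "openin S {h \<in> carrier \<Gamma>. act (g \<otimes> h \<otimes> inv g) x \<in> Y}"
proof (subst openin_subopen, intro ballI)
  fix h assume h: "h \<in> {h \<in> carrier \<Gamma>. act (g \<otimes> h \<otimes> inv g) x \<in> Y}"
  let ?t = "\<lambda>k. g \<otimes> (inv h \<otimes> k) \<otimes> inv g"
  let ?V = "{k \<in> topspace S. ?t k \<in> stabilizer \<Gamma> act x}"
  have "continuous_map S S ?t"
    using g h by (intro continuous_map_mult_const continuous_map_const_mult) auto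
  then have "openin S ?V" using op openin_continuous_map_preimage by blast
  moreover have "h \<in> ?V"
    using h g x act_one topspace_eq_carrier by (simp add: stabilizer_def)
  moreover have "?V \<subseteq> {h \<in> carrier \<Gamma>. act (g \<otimes> h \<otimes> inv g) x \<in> Y}"
  proof
    fix k assume k: "k \<in> ?V"
    then have kc: "k \<in> carrier \<Gamma>" using topspace_eq_carrier by simp
    have hc: "h \<in> carrier \<Gamma>" using h by simp
    have "(g \<otimes> h \<otimes> inv g) \<otimes> ?t k = g \<otimes> (h \<otimes> ((inv g \<otimes> g) \<otimes> (inv h \<otimes> k))) \<otimes> inv g"
      using g hc kc by (simp only: m_assoc m_closed inv_closed)
    also have "\<dots> = g \<otimes> k \<otimes> inv g"
      using g hc kc by (simp add: m_assoc[symmetric])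
    finally have "act (g \<otimes> k \<otimes> inv g) x = act (g \<otimes> h \<otimes> inv g) (act (?t k) x)"
      using act_mult[of "g \<otimes> h \<otimes> inv g" "?t k" x] g hc kc x by simp
    then show "k \<in> {h \<in> carrier \<Gamma>. act (g \<otimes> h \<otimes> inv g) x \<in> Y}"
      using k kc h by (simp add: stabilizer_def)
  qed
  ultimately show "\<exists>V. openin S V \<and> h \<in> V \<and> V \<subseteq> {h \<in> carrier \<Gamma>. act (g \<otimes> h \<otimes> inv g) x \<in> Y}"
    by blast
qed

text \<open>Each single conjugacy class moves \<open>x\<close> to finitely many points; the Baire category theorem makes this
  uniform near the identity. Since \<open>\<Gamma>\<close> is generated by finitely many elements together with the
  stabiliser, the orbit of \<open>x\<close> is an increasing union of finite sets \<open>Y n\<close>, and \<open>\<Gamma>\<close> is the union of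
  the closed sets of those \<open>h\<close> whose class moves \<open>x\<close> into \<open>Y n\<close>. One of them has interior; translating
  to the identity gives a neighbourhood of elements whose conjugates move \<open>x\<close> into a common finite
  set \<open>Z\<close>. All elements with this property that are conjugate into the stabiliser are periodic at
  \<open>x\<close>, and the version of Dietzmann's lemma above applies to the set \<open>D\<close> of them.\<close>

theorem open_normal_subgroup_finite_orbit:
  assumes lc: "locally_compact_space S" and haus: "Hausdorff_space S"
    and x: "x \<in> E" and op: "openin S (stabilizer \<Gamma> act x)"
    and F: "finite F" "F \<subseteq> carrier \<Gamma>" and gen: "generate \<Gamma> (F \<union> stabilizer \<Gamma> act x) = carrier \<Gamma>"
    and fin: "\<And>g. g \<in> carrier \<Gamma> \<Longrightarrow> finite (class_orbit g x)"
  shows "\<exists>M. M \<lhd> \<Gamma> \<and> openin S M \<and> finite ((\<lambda>g. act g x) ` M) \<and>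
             (\<forall>N. N \<lhd> \<Gamma> \<longrightarrow> N \<subseteq> stabilizer \<Gamma> act x \<longrightarrow> N \<subseteq> M)"
proof -
  let ?W = "stabilizer \<Gamma> act x"
  have W: "subgroup ?W \<Gamma>" using x by (rule stabilizer_subgroup)
  define F' where "F' = F \<union> m_inv \<Gamma> ` F"
  have F': "finite F'" "F' \<subseteq> carrier \<Gamma>" using F by (auto simp: F'_def)
  \<comment> \<open>Every \<open>Y n\<close> is invariant under the stabiliser, since each step adds images under whole conjugacy classes.\<close>
  define Y where "Y = rec_nat {x} (\<lambda>_ A. A \<union> (\<Union>y\<in>A. \<Union>f\<in>F'. class_orbit f y))"
  have Y0: "Y 0 = {x}" and YS: "Y (Suc n) = Y n \<union> (\<Union>y\<in>Y n. \<Union>f\<in>F'. class_orbit f y)" for n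
    by (simp_all add: Y_def)
  have orb: "Y n \<subseteq> (\<lambda>g. act g x) ` carrier \<Gamma>" for n
  proof (induction n)
    case 0
    have "x = act \<one> x" using act_one x by simp
    then show ?case by (auto simp: Y0)
  next
    case (Suc n)
    have "class_orbit f (act g x) \<subseteq> (\<lambda>g. act g x) ` carrier \<Gamma>" if "f \<in> F'" "g \<in> carrier \<Gamma>" for f g
    proof
      fix z assume "z \<in> class_orbit f (act g x)"
      then obtain c where c: "c \<in> conjugacy_class \<Gamma> f" "z = act c (act g x)" by (auto simp: class_orbit_def)
      then have "c \<in> carrier \<Gamma>" using conjugacy_class_carrier that F' by blast
      then show "z \<in> (\<lambda>g. act g x) ` carrier \<Gamma>"
        using c that x by (intro image_eqI[of _ _ "c \<otimes> g"]) (auto simp: act_mult)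
    qed
    then have "class_orbit f y \<subseteq> (\<lambda>g. act g x) ` carrier \<Gamma>" if "f \<in> F'" "y \<in> Y n" for f y
      using that Suc by blast
    then show ?case unfolding YS using Suc by blast
  qed
  have fin': "finite (class_orbit f y)" if f: "f \<in> carrier \<Gamma>" and y: "y \<in> Y n" for f y n
  proof -
    obtain g where "g \<in> carrier \<Gamma>" "y = act g x" using y orb by blast
    then show ?thesis using class_orbit_translate[of f g x] fin f x by simp
  qed
  have Yfin: "finite (Y n)" for n
  proof (induction n)
    case (Suc n)
    have "finite (class_orbit f y)" if "y \<in> Y n" "f \<in> F'" for f y
      using fin' F'(2) that by blast
    then show ?case using Suc F'(1) by (auto simp: YS)
  qed (simp add: Y0)
  have Ymono: "Y m \<subseteq> Y n" if "m \<le> n" for m n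
    using lift_Suc_mono_le[of Y m n] that YS by blast
  have YE: "Y n \<subseteq> E" for n using orb[of n] act_closed x by blast
  have WY: "act w y \<in> Y n" if w: "w \<in> ?W" and "y \<in> Y n" for w y n
    using that(2)
  proof (induction n arbitrary: y)
    case 0
    then show ?case using w by (simp add: Y0 stabilizer_def)
  next
    case (Suc n)
    show ?case
    proof (cases "y \<in> Y n")
      case False
      then obtain y' f where y': "y' \<in> Y n" "f \<in> F'" "y \<in> class_orbit f y'" using Suc.prems by (auto simp: YS)
      then have "act w y \<in> class_orbit f (act w y')"
        using class_orbit_translate[of f w y'] w F' YE[of n] by (auto simp: stabilizer_def)
      then show ?thesis using Suc.IH[OF y'(1)] y'(2) by (auto simp: YS)
    qed (use Suc.IH in \<open>auto simp: YS\<close>)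
  qed
  define U where "U = (\<Union>n. Y n)"
  have WU: "act w y \<in> U" if "w \<in> ?W" "y \<in> U" for w y
    using that WY unfolding U_def by blast
  have UE: "U \<subseteq> E" using YE by (auto simp: U_def)
  have FY: "act f y \<in> U" if f: "f \<in> F'" and y: "y \<in> U" for f y
  proof -
    obtain n where n: "y \<in> Y n" using y by (auto simp: U_def)
    have "act f y \<in> class_orbit f y"
      using self_in_conjugacy_class F' f by (auto simp: class_orbit_def)
    then have "act f y \<in> Y (Suc n)" using n f by (auto simp: YS)
    then show ?thesis unfolding U_def by blast
  qed
  have genY: "act g ` U \<subseteq> U" if "g \<in> generate \<Gamma> (F \<union> ?W)" for g
    using that
  proof (induction rule: generate.induct)
    case one
    then show ?case using UE act_one by auto
  next
    case (incl h)
    then have "h \<in> F' \<or> h \<in> ?W" by (auto simp: F'_def)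
    then show ?case using FY WU by blast
  next
    case (inv h)
    then have "inv h \<in> F' \<or> inv h \<in> ?W" using subgroup.m_inv_closed[OF W] by (auto simp: F'_def)
    then show ?case using FY WU by blast
  next
    case (eng h1 h2)
    then have c: "h1 \<in> carrier \<Gamma>" "h2 \<in> carrier \<Gamma>" using gen by auto
    show ?case
    proof
      fix z assume "z \<in> act (h1 \<otimes> h2) ` U"
      then obtain y where y: "y \<in> U" "z = act (h1 \<otimes> h2) y" by blast
      then have "z = act h1 (act h2 y)" using act_mult[OF c] UE by blast
      then show "z \<in> U" using y eng.IH by blast
    qed
  qed
  have xY: "x \<in> U" using Y0 unfolding U_def by blast
  have orbY: "act g x \<in> U" if "g \<in> carrier \<Gamma>" for g
    using genY[of g] xY that gen by blast
  have class_sub: "class_orbit h x \<subseteq> U" if "h \<in> carrier \<Gamma>" for h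
    using orbY conjugacy_class_carrier[OF that] by (auto simp: class_orbit_def)
  define C where "C n = {h \<in> carrier \<Gamma>. class_orbit h x \<subseteq> Y n}" for n
  have Cclosed: "closedin S (C n)" for n
  proof -
    have "carrier \<Gamma> - C n = (\<Union>g\<in>carrier \<Gamma>. {h \<in> carrier \<Gamma>. act (g \<otimes> h \<otimes> inv g) x \<in> - Y n})"
      by (auto simp: C_def class_orbit_def conjugacy_class_def)
    moreover have "openin S (\<Union>g\<in>carrier \<Gamma>. {h \<in> carrier \<Gamma>. act (g \<otimes> h \<otimes> inv g) x \<in> - Y n})"
      using open_conjugate_preimage[OF x op] by blast
    ultimately show ?thesis
      using topspace_eq_carrier by (auto simp: closedin_def C_def)
  qed
  have Ccover: "(\<Union>n. C n) = carrier \<Gamma>"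
  proof
    show "carrier \<Gamma> \<subseteq> (\<Union>n. C n)"
    proof
      fix h assume h: "h \<in> carrier \<Gamma>"
      have "\<forall>y\<in>class_orbit h x. \<exists>n. y \<in> Y n" using class_sub[OF h] unfolding U_def by blast
      then obtain N where N: "\<And>y. y \<in> class_orbit h x \<Longrightarrow> y \<in> Y (N y)" by metis
      have "class_orbit h x \<subseteq> Y (Max (N ` class_orbit h x))"
      proof
        fix y assume y: "y \<in> class_orbit h x"
        then have "N y \<le> Max (N ` class_orbit h x)" using fin[OF h] by simp
        then show "y \<in> Y (Max (N ` class_orbit h x))" using N[OF y] Ymono by blast
      qed
      then show "h \<in> (\<Union>n. C n)" using h by (auto simp: C_def)
    qed
  qed (auto simp: C_def)
  have "\<exists>n. S interior_of C n \<noteq> {}"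
  proof (rule ccontr)
    assume "\<not> ?thesis"
    then have "S interior_of \<Union>(range C) = {}"
      using Cclosed lc haus locally_compact_Hausdorff_imp_regular_space
      by (intro Baire_category_alt) auto
    moreover have "\<Union>(range C) = topspace S" using Ccover topspace_eq_carrier by simp
    ultimately have "topspace S = {}" using interior_of_topspace[of S] by metis
    then show False using topspace_eq_carrier one_closed by blast
  qed
  then obtain n h where h: "h \<in> S interior_of C n" by blast
  then have "h \<in> C n" using interior_of_subset by fastforce
  then have hc: "h \<in> carrier \<Gamma>" by (simp add: C_def)
  define Z where "Z = insert x (\<Union>y\<in>Y n. class_orbit (inv h) y)"
  have Zfin: "finite Z" using Yfin fin' hc by (auto simp: Z_def)
  \<comment> \<open>Conjugates of stabiliser elements are admitted to make \<open>D\<close> stable under conjugation.\<close>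
  define D where "D = {d \<in> carrier \<Gamma>. class_orbit d x \<subseteq> Z \<and> (\<exists>g\<in>carrier \<Gamma>. g \<otimes> d \<otimes> inv g \<in> ?W)}"
  define V where "V = {w \<in> topspace S. h \<otimes> w \<in> S interior_of C n} \<inter> ?W"
  have "continuous_map S S (\<lambda>w. h \<otimes> w)"
    using hc continuous_map_const_mult[of h S "\<lambda>w. w"] by simp
  then have Vop: "openin S V"
    unfolding V_def using op openin_continuous_map_preimage openin_interior_of by blast
  have V1: "\<one> \<in> V"
    using h hc x act_one topspace_eq_carrier by (auto simp: V_def stabilizer_def)
  have VD: "V \<subseteq> D"
  proof
    fix w assume w: "w \<in> V"
    then have wc: "w \<in> carrier \<Gamma>" and wW: "w \<in> ?W" by (auto simp: V_def topspace_eq_carrier)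
    have hw: "h \<otimes> w \<in> C n" using w interior_of_subset by (fastforce simp: V_def)
    have "class_orbit w x \<subseteq> Z"
    proof
      fix z assume "z \<in> class_orbit w x"
      then obtain g where g: "g \<in> carrier \<Gamma>" "z = act (g \<otimes> w \<otimes> inv g) x"
        by (auto simp: class_orbit_def conjugacy_class_def)
      define y where "y = act (g \<otimes> (h \<otimes> w) \<otimes> inv g) x"
      have "y \<in> Y n" using hw g by (auto simp: y_def C_def class_orbit_def conjugacy_class_def)
      have "(g \<otimes> inv h \<otimes> inv g) \<otimes> (g \<otimes> (h \<otimes> w) \<otimes> inv g)
              = g \<otimes> (inv h \<otimes> ((inv g \<otimes> g) \<otimes> (h \<otimes> w))) \<otimes> inv g"
        using g hc wc by (simp only: m_assoc m_closed inv_closed)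
      also have "\<dots> = g \<otimes> w \<otimes> inv g"
        using g hc wc by (simp add: m_assoc[symmetric])
      finally have "z = act (g \<otimes> inv h \<otimes> inv g) y"
        using act_mult[of "g \<otimes> inv h \<otimes> inv g" "g \<otimes> (h \<otimes> w) \<otimes> inv g" x] g hc wc x by (simp add: y_def)
      then show "z \<in> Z"
        using \<open>y \<in> Y n\<close> g(1) by (auto simp: Z_def class_orbit_def conjugacy_class_def)
    qed
    moreover have "\<one> \<otimes> w \<otimes> inv \<one> \<in> ?W" using wW wc by simp
    ultimately show "w \<in> D" using wc one_closed unfolding D_def by blast
  qed
  have Dconj: "a \<otimes> d \<otimes> inv a \<in> D" if a: "a \<in> carrier \<Gamma>" and d: "d \<in> D" for a d
  proof -
    have dc: "d \<in> carrier \<Gamma>" using d by (simp add: D_def)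
    obtain g where g: "g \<in> carrier \<Gamma>" "g \<otimes> d \<otimes> inv g \<in> ?W" using d by (auto simp: D_def)
    have "(g \<otimes> inv a) \<otimes> (a \<otimes> d \<otimes> inv a) \<otimes> inv (g \<otimes> inv a) = (g \<otimes> inv a \<otimes> a) \<otimes> d \<otimes> inv (g \<otimes> inv a \<otimes> a)"
      using a dc g(1) conjugate_conjugate by simp
    also have "g \<otimes> inv a \<otimes> a = g" using a g(1) by (simp add: m_assoc)
    finally have "(g \<otimes> inv a) \<otimes> (a \<otimes> d \<otimes> inv a) \<otimes> inv (g \<otimes> inv a) \<in> ?W" using g(2) by simp
    then have 1: "\<exists>g\<in>carrier \<Gamma>. g \<otimes> (a \<otimes> d \<otimes> inv a) \<otimes> inv g \<in> ?W"
      using a g(1) by (intro bexI[of _ "g \<otimes> inv a"]) auto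
    have "conjugacy_class \<Gamma> (a \<otimes> d \<otimes> inv a) \<subseteq> conjugacy_class \<Gamma> d"
      using conjugacy_class_conj_closed[of d] self_in_conjugacy_class[OF dc] dc a
      by (auto simp: conjugacy_class_def[of _ "a \<otimes> d \<otimes> inv a"])
    then have "class_orbit (a \<otimes> d \<otimes> inv a) x \<subseteq> Z"
      using d by (auto simp: D_def class_orbit_def)
    then show ?thesis using 1 a dc by (simp add: D_def)
  qed
  have Dc: "D \<subseteq> carrier \<Gamma>" by (auto simp: D_def)
  interpret conjugation_stable_set \<Gamma> E act D x
  proof
    have "(\<lambda>d. act d x) ` D \<subseteq> Z"
      using self_in_conjugacy_class by (auto simp: D_def class_orbit_def)
    then show "finite ((\<lambda>d. act d x) ` D)" using Zfin finite_subset by blast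
    show "periodic d x" if d: "d \<in> D" for d
    proof -
      have dc: "d \<in> carrier \<Gamma>" using d by (simp add: D_def)
      obtain g where g: "g \<in> carrier \<Gamma>" "g \<otimes> d \<otimes> inv g \<in> ?W" using d by (auto simp: D_def)
      have "periodic (g \<otimes> d \<otimes> inv g) x"
        using g dc unfolding periodic_def by (intro exI[of _ 1]) (simp add: stabilizer_def)
      then have "periodic (inv g \<otimes> (g \<otimes> d \<otimes> inv g) \<otimes> inv (inv g)) x"
        using periodic_conj[of "g \<otimes> d \<otimes> inv g" "inv g" x] g dc x fin by simp
      moreover have "inv g \<otimes> (g \<otimes> d \<otimes> inv g) \<otimes> inv (inv g) = d"
        using conjugate_conjugate[of "inv g" g d] g dc by simp
      ultimately show ?thesis by simp
    qed
  qed (use Dc x Dconj in auto)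
  let ?M = "generate \<Gamma> D"
  have "?M \<lhd> \<Gamma>" using Dc Dconj by (intro normal_generateI) auto
  moreover have "openin S ?M"
  proof (rule open_subgroupI[OF generate_is_subgroup[OF Dc] Vop V1])
    show "V \<subseteq> ?M" using VD by (auto intro: generate.incl)
  qed
  moreover have "N \<subseteq> ?M" if N: "N \<lhd> \<Gamma>" "N \<subseteq> ?W" for N
  proof
    fix a assume a: "a \<in> N"
    then have ac: "a \<in> carrier \<Gamma>" using N(2) by (auto simp: stabilizer_def)
    have "conjugacy_class \<Gamma> a \<subseteq> N"
      using normal.inv_op_closed2[OF N(1)] a by (auto simp: conjugacy_class_def)
    then have "class_orbit a x \<subseteq> Z" using N(2) by (auto simp: class_orbit_def stabilizer_def Z_def)
    moreover have "\<one> \<otimes> a \<otimes> inv \<one> \<in> ?W" using N(2) a ac by auto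
    ultimately have "a \<in> D" using ac one_closed unfolding D_def by blast
    then show "a \<in> ?M" by (rule generate.incl)
  qed
  ultimately show ?thesis using finite_orbit_generate by blast
qed

end

section \<open>Compact generation and relatively compact classes modulo a normal subgroup\<close>

context topological_group
begin

text \<open>A compact subset of \<open>G / N\<close> is covered by finitely many cosets of an open subgroup \<open>W\<close> containing \<open>N\<close>. This
  is the only way in which the topology of the quotient enters: both conditions on the factors of the series
  become statements about cosets of \<open>W\<close> in \<open>G\<close> itself.\<close>

lemma compact_in_quotient_finite_cosets:
  assumes N: "N \<lhd> G" and W: "subgroup W G" "openin T W" "N \<subseteq> W"
    and K: "compactin (quotient_topology T (\<lambda>x. N #> x)) K"
  shows "\<exists>F. finite F \<and> F \<subseteq> carrier G \<and> (\<forall>h\<in>carrier G. N #> h \<in> K \<longrightarrow> (\<exists>f\<in>F. h \<in> f <# W))"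
proof -
  interpret N: normal N G by fact
  have WG: "W \<subseteq> carrier G" using W(1) subgroup.subset by blast
  let ?\<pi> = "\<lambda>x. N #> x" and ?Q = "quotient_topology T (\<lambda>x. N #> x)"
  have pre: "x \<in> f <# W" if f: "f \<in> carrier G" and x: "x \<in> carrier G" and im: "N #> x \<in> ?\<pi> ` (f <# W)" for f x
  proof -
    obtain w where w: "w \<in> W" "N #> x = N #> (f \<otimes> w)" using im by (auto simp: l_coset_def)
    have "x \<in> N #> (f \<otimes> w)" using rcos_self[OF x] N.subgroup_axioms w(2) by blast
    then obtain m where m: "m \<in> N" "x = m \<otimes> (f \<otimes> w)" by (auto simp: r_coset_def)
    have mc: "m \<in> carrier G" and wc: "w \<in> carrier G" using m(1) w(1) WG N.subset by auto
    have "inv f \<otimes> m \<otimes> f \<in> W" using N.inv_op_closed1[OF f m(1)] W(3) by blast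
    then have "(inv f \<otimes> m \<otimes> f) \<otimes> w \<in> W" using w(1) subgroup.m_closed[OF W(1)] by blast
    moreover have "f \<otimes> ((inv f \<otimes> m \<otimes> f) \<otimes> w) = x"
      using f mc wc m(2) by (simp add: m_assoc[symmetric])
    ultimately show ?thesis by (auto simp: l_coset_def)
  qed
  let ?\<U> = "(\<lambda>f. ?\<pi> ` (f <# W)) ` carrier G"
  have "\<exists>\<F>. finite \<F> \<and> \<F> \<subseteq> ?\<U> \<and> K \<subseteq> \<Union>\<F>"
  proof (rule compactinD[OF K])
    fix V assume "V \<in> ?\<U>"
    then obtain f where f: "f \<in> carrier G" "V = ?\<pi> ` (f <# W)" by blast
    have fW: "f <# W \<subseteq> carrier G" using f(1) WG by (auto simp: l_coset_def)
    have "{x \<in> topspace T. ?\<pi> x \<in> V} = f <# W"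
      using pre[OF f(1)] fW topspace_eq_carrier unfolding f(2) by blast
    then show "openin ?Q V"
      using openin_lcoset[OF W(2) f(1)] fW topspace_eq_carrier f(2)
      by (auto simp: openin_quotient_topology)
  next
    show "K \<subseteq> \<Union>?\<U>"
    proof
      fix k assume "k \<in> K"
      then obtain h where h: "h \<in> carrier G" "k = N #> h"
        using compactin_subset_topspace[OF K] topspace_eq_carrier by (auto simp: topspace_quotient_topology)
      have "h \<in> h <# W"
        using h subgroup.one_closed[OF W(1)] by (auto simp: l_coset_def intro!: bexI[of _ \<one>])
      then show "k \<in> \<Union>?\<U>" using h by blast
    qed
  qed
  then obtain \<F> where "finite \<F>" "\<F> \<subseteq> ?\<U>" "K \<subseteq> \<Union>\<F>" by blast
  then obtain F where F: "finite F" "F \<subseteq> carrier G" "\<F> = (\<lambda>f. ?\<pi> ` (f <# W)) ` F"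
    using finite_subset_image by meson
  have "\<exists>f\<in>F. h \<in> f <# W" if h: "h \<in> carrier G" "N #> h \<in> K" for h
  proof -
    obtain f where f: "f \<in> F" "N #> h \<in> ?\<pi> ` (f <# W)" using h(2) \<open>K \<subseteq> \<Union>\<F>\<close> F(3) by blast
    then have "h \<in> f <# W" using pre[OF _ h(1)] F(2) by blast
    then show ?thesis using f(1) by blast
  qed
  then show ?thesis using F(1,2) by blast
qed

lemma compactly_generated_quotient_imp_finitely_generated_over_open:
  assumes N: "N \<lhd> G" and W: "subgroup W G" "openin T W" "N \<subseteq> W"
    and cg: "compactly_generated (G Mod N) (quotient_topology T (\<lambda>x. N #> x))"
  shows "\<exists>F. finite F \<and> F \<subseteq> carrier G \<and> generate G (F \<union> W) = carrier G"
proof -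
  interpret N: normal N G by fact
  have WG: "W \<subseteq> carrier G" using W(1) subgroup.subset by blast
  obtain K where K: "compactin (quotient_topology T (\<lambda>x. N #> x)) K"
      and gen: "generate (G Mod N) K = carrier (G Mod N)"
    using cg by (auto simp: compactly_generated_def)
  obtain F where F: "finite F" "F \<subseteq> carrier G"
      and cov: "\<And>h. h \<in> carrier G \<Longrightarrow> N #> h \<in> K \<Longrightarrow> \<exists>f\<in>F. h \<in> f <# W"
    using compact_in_quotient_finite_cosets[OF N W K] by blast
  define P where "P = generate G (F \<union> W)"
  have FW: "F \<union> W \<subseteq> carrier G" using F WG by blast
  have P: "subgroup P G" unfolding P_def using FW by (rule generate_is_subgroup)
  have FWP: "F \<union> W \<subseteq> P" unfolding P_def by (auto intro: generate.incl)
  have KQ: "K \<subseteq> carrier (G Mod N)"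
    using compactin_subset_topspace[OF K] topspace_eq_carrier
    by (auto simp: topspace_quotient_topology FactGroup_def RCOSETS_def)
  have inK: "A \<subseteq> P" if A: "A \<in> K" for A
  proof
    fix a assume a: "a \<in> A"
    obtain h where h: "h \<in> carrier G" "A = N #> h"
      using A KQ by (auto simp: FactGroup_def RCOSETS_def)
    have ac: "a \<in> carrier G" using a h r_coset_subset_G N.subset by blast
    have "N #> a = A" using a h repr_independence[OF _ h(1) N.subgroup_axioms] by simp
    then obtain f where f: "f \<in> F" "a \<in> f <# W" using cov[OF ac] A by blast
    then obtain w where "w \<in> W" "a = f \<otimes> w" by (auto simp: l_coset_def)
    then show "a \<in> P" using f FWP subgroup.m_closed[OF P] by blast
  qed
  have sub: "A \<subseteq> P" if "A \<in> generate (G Mod N) K" for A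
    using that
  proof (induction rule: generate.induct)
    case one
    then show ?case using W(3) FWP by (auto simp: FactGroup_def)
  next
    case (incl A)
    then show ?case by (rule inK)
  next
    case (inv A)
    then have "inv\<^bsub>G Mod N\<^esub> A = set_inv A" using KQ N.inv_FactGroup by blast
    then show ?case using inK[OF inv] subgroup.m_inv_closed[OF P] by (auto simp: SET_INV_def)
  next
    case (eng A B)
    then show ?case using subgroup.m_closed[OF P] by (auto simp: FactGroup_def set_mult_def)
  qed
  have "carrier G \<subseteq> P"
  proof
    fix h assume h: "h \<in> carrier G"
    then have "N #> h \<in> carrier (G Mod N)" by (auto simp: FactGroup_def RCOSETS_def)
    then have "N #> h \<subseteq> P" using sub gen by blast
    then show "h \<in> P" using rcos_self[OF h] N.subgroup_axioms by blast
  qed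
  then have "generate G (F \<union> W) = carrier G" using subgroup.subset[OF P] P_def by simp
  then show ?thesis using F by blast
qed

end

context topological_acting_group
begin

lemma relatively_compact_classes_imp_finite_class_orbit:
  assumes N: "N \<lhd> \<Gamma>"
    and rc: "relatively_compact_conjugacy_classes (\<Gamma> Mod N) (quotient_topology S (\<lambda>y. N #> y))"
    and x: "x \<in> E" "openin S (stabilizer \<Gamma> act x)" "N \<subseteq> stabilizer \<Gamma> act x"
    and h: "h \<in> carrier \<Gamma>"
  shows "finite (class_orbit h x)"
proof -
  interpret N: normal N \<Gamma> by fact
  interpret Q: group "\<Gamma> Mod N" by (rule N.factorgroup_is_group)
  let ?\<pi> = "\<lambda>y. N #> y" and ?Q = "quotient_topology S (\<lambda>y. N #> y)"
  have \<pi>: "?\<pi> g \<in> carrier (\<Gamma> Mod N)" if "g \<in> carrier \<Gamma>" for g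
    using that by (auto simp: FactGroup_def RCOSETS_def)
  let ?C = "conjugacy_class (\<Gamma> Mod N) (?\<pi> h)"
  have "?C \<subseteq> carrier (\<Gamma> Mod N)" using \<pi>[OF h] Q.m_closed Q.inv_closed unfolding conjugacy_class_def by blast
  then have "?C \<subseteq> topspace ?Q"
    using topspace_eq_carrier by (auto simp: topspace_quotient_topology FactGroup_def RCOSETS_def)
  then have sub: "?C \<subseteq> ?Q closure_of ?C" by (rule closure_of_subset)
  have comp: "compactin ?Q (?Q closure_of ?C)"
    using rc \<pi>[OF h] by (auto simp: relatively_compact_conjugacy_classes_def)
  obtain F where F: "finite F" "F \<subseteq> carrier \<Gamma>"
      and cov: "\<forall>g\<in>carrier \<Gamma>. ?\<pi> g \<in> ?Q closure_of ?C \<longrightarrow> (\<exists>f\<in>F. g \<in> f <# stabilizer \<Gamma> act x)"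
    using compact_in_quotient_finite_cosets[OF N stabilizer_subgroup[OF x(1)] x(2,3) comp] by auto
  have "class_orbit h x \<subseteq> (\<lambda>f. act f x) ` F"
  proof
    fix z assume "z \<in> class_orbit h x"
    then obtain g where g: "g \<in> carrier \<Gamma>" "z = act (g \<otimes> h \<otimes> inv g) x"
      by (auto simp: class_orbit_def conjugacy_class_def)
    have "?\<pi> (g \<otimes> h \<otimes> inv g) = ?\<pi> g \<otimes>\<^bsub>\<Gamma> Mod N\<^esub> ?\<pi> h \<otimes>\<^bsub>\<Gamma> Mod N\<^esub> inv\<^bsub>\<Gamma> Mod N\<^esub> (?\<pi> g)"
      using g h N.rcos_sum N.rcos_inv N.inv_FactGroup[OF \<pi>[OF g(1)]] by simp
    then have "?\<pi> (g \<otimes> h \<otimes> inv g) \<in> ?C" using \<pi>[OF g(1)] unfolding conjugacy_class_def by blast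
    then have "?\<pi> (g \<otimes> h \<otimes> inv g) \<in> ?Q closure_of ?C" using sub by blast
    then obtain f where f: "f \<in> F" "g \<otimes> h \<otimes> inv g \<in> f <# stabilizer \<Gamma> act x"
      using cov g(1) h by (meson inv_closed m_closed)
    then obtain w where w: "w \<in> stabilizer \<Gamma> act x" "g \<otimes> h \<otimes> inv g = f \<otimes> w" by (auto simp: l_coset_def)
    have "act (f \<otimes> w) x = act f (act w x)"
      using act_mult[of f w x] f(1) F(2) w(1) x(1) by (auto simp: stabilizer_def)
    then have "z = act f x" using g(2) w by (simp add: stabilizer_def)
    then show "z \<in> (\<lambda>f. act f x) ` F" using f(1) by blast
  qed
  then show ?thesis using F(1) finite_subset by blast
qed

end

section \<open>Invariant neighbourhoods of a fixed point of a distal action\<close>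

text \<open>Passing from distality to invariant neighbourhoods is a matter of topological dynamics at a fixed
  point \<open>e\<close>; it will be applied to the identity of a group. Compact open neighbourhoods of \<open>e\<close> take
  the place of compact open subgroups.\<close>

locale pointed_action = topological_group \<Gamma> S
  for \<Gamma> :: "('g, 'm) monoid_scheme" (structure) and S +
  fixes T :: "'a topology" and \<phi> :: "'g \<Rightarrow> 'a \<Rightarrow> 'a" and e :: 'a
  assumes \<phi>_one: "x \<in> topspace T \<Longrightarrow> \<phi> \<one> x = x"
    and \<phi>_mult: "g \<in> carrier \<Gamma> \<Longrightarrow> h \<in> carrier \<Gamma> \<Longrightarrow> x \<in> topspace T \<Longrightarrow> \<phi> (g \<otimes> h) x = \<phi> g (\<phi> h x)"
    and \<phi>_continuous: "continuous_map (prod_topology S T) T (\<lambda>(\<gamma>, x). \<phi> \<gamma> x)"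
    and base_point: "e \<in> topspace T" and \<phi>_base_point: "g \<in> carrier \<Gamma> \<Longrightarrow> \<phi> g e = e"
    and Hausdorff: "Hausdorff_space T" and distal: "distal_action \<Gamma> T \<phi>"
begin

lemma continuous_map_\<phi>:
  assumes "g \<in> carrier \<Gamma>"
  shows "continuous_map T T (\<phi> g)"
proof -
  have "continuous_map T (prod_topology S T) (\<lambda>x. (g, x))"
    using assms topspace_eq_carrier by (simp add: continuous_map_pairedI)
  from continuous_map_compose[OF this \<phi>_continuous] show ?thesis by (simp add: o_def)
qed

lemma \<phi>_closed: "g \<in> carrier \<Gamma> \<Longrightarrow> x \<in> topspace T \<Longrightarrow> \<phi> g x \<in> topspace T"
  using continuous_map_\<phi> by (auto simp: continuous_map_def)

lemma \<phi>_inv: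
  assumes "g \<in> carrier \<Gamma>" "x \<in> topspace T"
  shows "\<phi> (inv g) (\<phi> g x) = x" "\<phi> g (\<phi> (inv g) x) = x"
  using \<phi>_mult[of "inv g" g x] \<phi>_mult[of g "inv g" x] \<phi>_one assms by auto

sublocale sets: topological_acting_group \<Gamma> "Pow (topspace T)" "\<lambda>g V. \<phi> g ` V" S
proof unfold_locales
  show "\<phi> g ` V \<in> Pow (topspace T)" if "g \<in> carrier \<Gamma>" "V \<in> Pow (topspace T)" for g V
    using that \<phi>_closed by auto
  show "\<phi> \<one> ` V = V" if "V \<in> Pow (topspace T)" for V
  proof -
    have "\<phi> \<one> ` V = (\<lambda>x. x) ` V" using that \<phi>_one by (intro image_cong) auto
    then show ?thesis by simp
  qed
  show "\<phi> (g \<otimes> h) ` V = \<phi> g ` \<phi> h ` V"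
    if "g \<in> carrier \<Gamma>" "h \<in> carrier \<Gamma>" "V \<in> Pow (topspace T)" for g h V
    using that \<phi>_mult by (auto simp: image_image intro!: image_cong)
qed

definition compact_open_nbhd :: "'a set \<Rightarrow> bool" where
  "compact_open_nbhd V \<longleftrightarrow> compactin T V \<and> openin T V \<and> e \<in> V"

lemma compact_open_nbhd_subset: "compact_open_nbhd V \<Longrightarrow> V \<subseteq> topspace T"
  by (simp add: compact_open_nbhd_def openin_subset)

lemma image_\<phi>_eq_preimage:
  assumes "g \<in> carrier \<Gamma>" "V \<subseteq> topspace T"
  shows "\<phi> g ` V = {x \<in> topspace T. \<phi> (inv g) x \<in> V}"
proof
  show "\<phi> g ` V \<subseteq> {x \<in> topspace T. \<phi> (inv g) x \<in> V}"
    using assms \<phi>_closed \<phi>_inv(1) by auto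
  show "{x \<in> topspace T. \<phi> (inv g) x \<in> V} \<subseteq> \<phi> g ` V"
    using assms \<phi>_inv(2) by (auto intro!: image_eqI)
qed

lemma compact_open_nbhd_image:
  assumes g: "g \<in> carrier \<Gamma>" and V: "compact_open_nbhd V"
  shows "compact_open_nbhd (\<phi> g ` V)"
proof -
  have "compactin T (\<phi> g ` V)"
    using V continuous_map_\<phi>[OF g] image_compactin by (auto simp: compact_open_nbhd_def)
  moreover have "openin T {x \<in> topspace T. \<phi> (inv g) x \<in> V}"
    using V g continuous_map_\<phi>[of "inv g"] openin_continuous_map_preimage by (auto simp: compact_open_nbhd_def)
  then have "openin T (\<phi> g ` V)"
    using image_\<phi>_eq_preimage[OF g compact_open_nbhd_subset[OF V]] by simp
  moreover have "e \<in> \<phi> g ` V"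
    using V \<phi>_base_point[OF g] by (force simp: compact_open_nbhd_def)
  ultimately show ?thesis by (simp add: compact_open_nbhd_def)
qed

lemma compact_open_nbhd_Inter:
  assumes "finite \<V>" "\<V> \<noteq> {}" "\<And>V. V \<in> \<V> \<Longrightarrow> compact_open_nbhd V"
  shows "compact_open_nbhd (\<Inter>\<V>)"
proof -
  obtain V where V: "V \<in> \<V>" using assms(2) by blast
  have "closedin T (\<Inter>\<V>)"
    using assms Hausdorff compactin_imp_closedin by (intro closedin_Inter) (auto simp: compact_open_nbhd_def)
  then have "compactin T (\<Inter>\<V>)"
    using closed_compactin[of T V "\<Inter>\<V>"] assms(3)[OF V] V by (auto simp: compact_open_nbhd_def)
  moreover have "openin T (\<Inter>\<V>)"
    using assms by (intro openin_Inter) (auto simp: compact_open_nbhd_def)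
  ultimately show ?thesis using assms(3) by (auto simp: compact_open_nbhd_def)
qed

text \<open>By the tube lemma, elements close to the identity map the compact set \<open>V\<close> into its neighbourhood
  \<open>V\<close>; for equality apply this to inverses as well.\<close>

lemma openin_stabilizer:
  assumes V: "compact_open_nbhd V"
  shows "openin S (stabilizer \<Gamma> (\<lambda>g V. \<phi> g ` V) V)"
proof -
  let ?W = "{p \<in> topspace (prod_topology S T). (\<lambda>(\<gamma>, x). \<phi> \<gamma> x) p \<in> V}"
  have VT: "V \<subseteq> topspace T" using V by (rule compact_open_nbhd_subset)
  have "openin (prod_topology S T) ?W"
    using V \<phi>_continuous openin_continuous_map_preimage unfolding compact_open_nbhd_def by blast
  moreover have "{\<one>} \<times> V \<subseteq> ?W" using VT \<phi>_one topspace_eq_carrier by auto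
  ultimately obtain U V' where U: "openin S U" "\<one> \<in> U" "V \<subseteq> V'" "U \<times> V' \<subseteq> ?W"
    using tube_lemma_right[of S T ?W V \<one>] V topspace_eq_carrier unfolding compact_open_nbhd_def by auto
  have UV: "\<phi> g ` V \<subseteq> V" if "g \<in> U" for g
  proof
    fix z assume "z \<in> \<phi> g ` V"
    then obtain x where x: "x \<in> V" "z = \<phi> g x" by blast
    then have "(g, x) \<in> ?W" using U(3,4) that by blast
    then show "z \<in> V" using x(2) by simp
  qed
  let ?U = "U \<inter> {g \<in> topspace S. inv g \<in> U}"
  have "openin S ?U" using U(1) continuous_inv openin_continuous_map_preimage by blast
  moreover have "\<one> \<in> ?U" using U(2) topspace_eq_carrier by simp
  moreover have "?U \<subseteq> stabilizer \<Gamma> (\<lambda>g V. \<phi> g ` V) V"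
  proof
    fix g assume g: "g \<in> ?U"
    then have gc: "g \<in> carrier \<Gamma>" using topspace_eq_carrier by simp
    have "\<phi> g ` V = V"
    proof
      show "\<phi> g ` V \<subseteq> V" using UV g by blast
      have "\<phi> (inv g) ` V \<subseteq> V" using UV g by blast
      then show "V \<subseteq> \<phi> g ` V" using image_\<phi>_eq_preimage[OF gc VT] VT by auto
    qed
    then show "g \<in> stabilizer \<Gamma> (\<lambda>g V. \<phi> g ` V) V" using gc by (simp add: stabilizer_def)
  qed
  ultimately show ?thesis
    by (rule open_subgroupI[OF sets.stabilizer_subgroup[OF PowI[OF VT]]])
qed

lemma funpow_\<phi>:
  assumes "g \<in> carrier \<Gamma>" "x \<in> topspace T"
  shows "(\<phi> g ^^ k) x = \<phi> (g [^] k) x"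
proof (induction k)
  case (Suc k)
  have "g [^] Suc k = g \<otimes> g [^] k" using assms(1) by (rule nat_pow_Suc2)
  then show ?case using Suc assms \<phi>_mult by simp
qed (use assms \<phi>_one in simp)

lemma forward_invariant_compact_imp_invariant:
  assumes g: "g \<in> carrier \<Gamma>" and K: "compactin T K" "\<phi> g ` K \<subseteq> K"
  shows "\<phi> g ` K = K"
proof (rule distal_self_map_surj[OF Hausdorff K(1)])
  have KT: "K \<subseteq> topspace T" using K(1) by (rule compactin_subset_topspace)
  show "continuous_map (subtopology T K) (subtopology T K) (\<phi> g)"
    using continuous_map_\<phi>[OF g] K(2) by (auto simp: continuous_map_in_subtopology intro: continuous_map_from_subtopology)
  fix x y assume xy: "x \<in> K" "y \<in> K" "x \<noteq> y"
  have "{((\<phi> g ^^ k) x, (\<phi> g ^^ k) y) | k. True} \<subseteq> {(\<phi> \<gamma> x, \<phi> \<gamma> y) | \<gamma>. \<gamma> \<in> carrier \<Gamma>}"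
    using xy KT g by (auto simp: funpow_\<phi> subset_iff)
  then have "prod_topology T T closure_of {((\<phi> g ^^ k) x, (\<phi> g ^^ k) y) | k. True}
      \<subseteq> prod_topology T T closure_of {(\<phi> \<gamma> x, \<phi> \<gamma> y) | \<gamma>. \<gamma> \<in> carrier \<Gamma>}"
    by (rule closure_of_mono)
  moreover have "(prod_topology T T closure_of {(\<phi> \<gamma> x, \<phi> \<gamma> y) | \<gamma>. \<gamma> \<in> carrier \<Gamma>}) \<inter>
      {(z, z) | z. z \<in> topspace T} = {}"
    using distal xy KT unfolding distal_action_def by blast
  ultimately show "(prod_topology T T closure_of {((\<phi> g ^^ k) x, (\<phi> g ^^ k) y) | k. True}) \<inter>
      {(z, z) | z. z \<in> topspace T} = {}"
    by blast
qed

text \<open>The case of a single transformation \<open>g\<close>. The compact set \<open>N\<close> of points whose whole backward orbit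
  lies in \<open>U\<close> is mapped into itself by \<open>g\<^sup>-\<^sup>1\<close>, hence onto itself by distality, so \<open>N\<close> lies in \<open>g\<^sup>-\<^sup>1 U\<close>. By
  compactness a finite intersection \<open>V\<close> of translates of \<open>U\<close> lies in \<open>g\<^sup>-\<^sup>1 U\<close>. Then \<open>g\<close> maps \<open>V\<close> into
  itself, and distality gives equality once more.\<close>

lemma invariant_finite_intersection:
  assumes g: "g \<in> carrier \<Gamma>" and U: "compact_open_nbhd U"
  shows "\<exists>n::nat. \<phi> g ` (\<Inter>i\<le>n. \<phi> (g [^] i) ` U) = (\<Inter>i\<le>n. \<phi> (g [^] i) ` U)"
proof -
  define A where "A i = \<phi> (g [^] (i::nat)) ` U" for i
  have UT: "U \<subseteq> topspace T" using U by (rule compact_open_nbhd_subset)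
  have A: "compact_open_nbhd (A i)" for i unfolding A_def using g U by (intro compact_open_nbhd_image) auto
  have A0: "A 0 = U" using sets.act_one UT by (auto simp: A_def)
  have AS: "A (Suc i) = \<phi> g ` A i" for i
  proof -
    have "g [^] Suc i = g \<otimes> g [^] i" using g by (rule nat_pow_Suc2)
    then show ?thesis using sets.act_mult[of g "g [^] i" U] g UT by (simp add: A_def)
  qed
  define N where "N = (\<Inter>i. A i)"
  have NU: "N \<subseteq> U" using A0 by (auto simp: N_def)
  have "closedin T N"
    unfolding N_def using A Hausdorff compactin_imp_closedin
    by (intro closedin_INT) (auto simp: compact_open_nbhd_def)
  then have N: "compactin T N"
    using closed_compactin NU U unfolding compact_open_nbhd_def by blast
  have "\<phi> (inv g) ` N \<subseteq> N"
  proof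
    fix z assume "z \<in> \<phi> (inv g) ` N"
    then obtain y where y: "y \<in> N" "z = \<phi> (inv g) y" by blast
    have "z \<in> A i" for i
    proof -
      have "y \<in> \<phi> g ` A i" using y(1) AS[of i] by (auto simp: N_def)
      then show ?thesis using y(2) image_\<phi>_eq_preimage[OF g compact_open_nbhd_subset[OF A]] by simp
    qed
    then show "z \<in> N" by (simp add: N_def)
  qed
  then have "\<phi> (inv g) ` N = N" using N g by (intro forward_invariant_compact_imp_invariant) auto
  then have NO: "N \<subseteq> \<phi> (inv g) ` U" using NU by blast
  \<comment> \<open>Compactness: already a finite part of the intersection \<open>N\<close> lies in this neighbourhood of \<open>N\<close>.\<close>
  let ?O = "\<phi> (inv g) ` U"
  have O: "compact_open_nbhd ?O" using g U by (intro compact_open_nbhd_image) auto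
  have "closedin T (U - ?O)"
    using U O Hausdorff compactin_imp_closedin by (auto simp: compact_open_nbhd_def)
  then have comp: "compactin T (U - ?O)"
    using closed_compactin[of T U "U - ?O"] U unfolding compact_open_nbhd_def by blast
  let ?C = "range (\<lambda>i. topspace T - A i)"
  have "\<exists>\<F>. finite \<F> \<and> \<F> \<subseteq> ?C \<and> U - ?O \<subseteq> \<Union>\<F>"
  proof (rule compactinD[OF comp])
    show "openin T V" if "V \<in> ?C" for V
      using that A Hausdorff compactin_imp_closedin by (auto simp: compact_open_nbhd_def)
    show "U - ?O \<subseteq> \<Union>?C" using NO UT by (auto simp: N_def)
  qed
  then obtain \<F> where \<F>: "finite \<F>" "\<F> \<subseteq> ?C" "U - ?O \<subseteq> \<Union>\<F>" by blast
  obtain I where I: "finite I" "\<F> = (\<lambda>i. topspace T - A i) ` I"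
    using finite_subset_image[OF \<F>(1,2)] by blast
  define n where "n = Max (insert 0 I)"
  define V where "V = (\<Inter>i\<le>n. A i)"
  have In: "i \<le> n" if "i \<in> I" for i using that I(1) by (simp add: n_def)
  have VU: "V \<subseteq> U" using A0 by (auto simp: V_def)
  have VO: "V \<subseteq> ?O"
  proof
    fix v assume v: "v \<in> V"
    show "v \<in> ?O"
    proof (rule ccontr)
      assume "v \<notin> ?O"
      then obtain i where "i \<in> I" "v \<notin> A i" using \<F>(3) I(2) v VU by blast
      then show False using v In by (auto simp: V_def)
    qed
  qed
  have nV: "compact_open_nbhd V" unfolding V_def using A by (intro compact_open_nbhd_Inter) auto
  have "\<phi> g ` V \<subseteq> V"
  proof
    fix z assume "z \<in> \<phi> g ` V"
    then obtain v where v: "v \<in> V" "z = \<phi> g v" by blast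
    have "z \<in> A i" if "i \<le> n" for i
    proof (cases i)
      case 0
      have "v \<in> ?O" using VO v(1) by blast
      then have "\<phi> (inv (inv g)) v \<in> U"
        using image_\<phi>_eq_preimage[of "inv g" U] g UT by simp
      then show ?thesis using 0 A0 g v(2) by simp
    next
      case (Suc j)
      then have "v \<in> A j" using v(1) that by (auto simp: V_def)
      then show ?thesis using AS[of j] Suc v(2) by auto
    qed
    then show "z \<in> V" by (auto simp: V_def)
  qed
  then have "\<phi> g ` V = V"
    using nV g by (intro forward_invariant_compact_imp_invariant) (auto simp: compact_open_nbhd_def)
  then show ?thesis unfolding V_def A_def by blast
qed

text \<open>The last part says that invariance under a normal subgroup, once achieved, survives later
  intersections; this is what allows the groups involved to be treated one after the other.\<close>

lemma finite_orbit_intersection: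
  assumes H: "subgroup H \<Gamma>" and X: "compact_open_nbhd X" and fin: "finite ((\<lambda>h. \<phi> h ` X) ` H)"
  shows "compact_open_nbhd (\<Inter>h\<in>H. \<phi> h ` X)" "(\<Inter>h\<in>H. \<phi> h ` X) \<subseteq> X"
    "H \<subseteq> stabilizer \<Gamma> (\<lambda>g V. \<phi> g ` V) (\<Inter>h\<in>H. \<phi> h ` X)"
    "\<And>N. N \<lhd> \<Gamma> \<Longrightarrow> N \<subseteq> stabilizer \<Gamma> (\<lambda>g V. \<phi> g ` V) X \<Longrightarrow>
      N \<subseteq> stabilizer \<Gamma> (\<lambda>g V. \<phi> g ` V) (\<Inter>h\<in>H. \<phi> h ` X)"
proof -
  let ?Y = "\<Inter>h\<in>H. \<phi> h ` X"
  have XT: "X \<subseteq> topspace T" using X by (rule compact_open_nbhd_subset)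
  have Hc: "\<And>h. h \<in> H \<Longrightarrow> h \<in> carrier \<Gamma>" using subgroup.subset[OF H] by blast
  have H1: "\<one> \<in> H" using subgroup.one_closed[OF H] .
  show nY: "compact_open_nbhd ?Y"
    using fin H1 X Hc compact_open_nbhd_image by (intro compact_open_nbhd_Inter) auto
  show YX: "?Y \<subseteq> X" using H1 sets.act_one[of X] XT by auto
  have stab: "P \<subseteq> stabilizer \<Gamma> (\<lambda>g V. \<phi> g ` V) ?Y"
    if P: "subgroup P \<Gamma>" "\<And>p h. p \<in> P \<Longrightarrow> h \<in> H \<Longrightarrow> \<exists>k\<in>H. \<phi> h ` X = \<phi> p ` \<phi> k ` X" for P
  proof
    have sub: "\<phi> p ` ?Y \<subseteq> ?Y" if "p \<in> P" for p
    proof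
      fix z assume "z \<in> \<phi> p ` ?Y"
      then obtain y where y: "y \<in> ?Y" "z = \<phi> p y" by blast
      have "z \<in> \<phi> h ` X" if "h \<in> H" for h
      proof -
        have "\<exists>k\<in>H. \<phi> h ` X = \<phi> p ` \<phi> k ` X" using P(2)[OF \<open>p \<in> P\<close> that] .
        then obtain k where "k \<in> H" "\<phi> h ` X = \<phi> p ` \<phi> k ` X" by blast
        then show ?thesis using y by auto
      qed
      then show "z \<in> ?Y" by blast
    qed
    fix p assume p: "p \<in> P"
    then have pc: "p \<in> carrier \<Gamma>" using subgroup.subset[OF P(1)] by blast
    have YT: "?Y \<subseteq> topspace T" using YX XT by blast
    have "\<phi> (inv p) ` ?Y \<subseteq> ?Y" using sub subgroup.m_inv_closed[OF P(1) p] .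
    then have "\<phi> p ` \<phi> (inv p) ` ?Y \<subseteq> \<phi> p ` ?Y" by blast
    then have "?Y \<subseteq> \<phi> p ` ?Y" using sets.act_inv(2)[OF pc PowI[OF YT]] by (simp only:)
    with sub[OF p] have "\<phi> p ` ?Y = ?Y" by (rule subset_antisym)
    then show "p \<in> stabilizer \<Gamma> (\<lambda>g V. \<phi> g ` V) ?Y"
      using pc unfolding stabilizer_def by blast
  qed
  show "H \<subseteq> stabilizer \<Gamma> (\<lambda>g V. \<phi> g ` V) ?Y"
  proof (rule stab[OF H])
    fix p h assume ph: "p \<in> H" "h \<in> H"
    have "inv p \<otimes> h \<in> H" using ph subgroup.m_closed[OF H] subgroup.m_inv_closed[OF H] by blast
    moreover have "p \<otimes> (inv p \<otimes> h) = h" using ph Hc by (simp add: m_assoc[symmetric])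
    ultimately show "\<exists>k\<in>H. \<phi> h ` X = \<phi> p ` \<phi> k ` X"
      using sets.act_mult[of p "inv p \<otimes> h" X] XT Hc ph by (intro bexI[of _ "inv p \<otimes> h"]) auto
  qed
  show "N \<subseteq> stabilizer \<Gamma> (\<lambda>g V. \<phi> g ` V) ?Y"
    if N: "N \<lhd> \<Gamma>" "N \<subseteq> stabilizer \<Gamma> (\<lambda>g V. \<phi> g ` V) X" for N
  proof (rule stab)
    show "subgroup N \<Gamma>" using N(1) by (simp add: normal_imp_subgroup)
    fix p h assume "p \<in> N" "h \<in> H"
    then have "\<phi> p ` \<phi> h ` X = \<phi> h ` X"
      using subsetD[OF sets.normal_fixes_translate[OF N(1) PowI[OF XT] N(2) Hc]] by (simp add: stabilizer_def)
    then show "\<exists>k\<in>H. \<phi> h ` X = \<phi> p ` \<phi> k ` X" using \<open>h \<in> H\<close> by (intro bexI[of _ h]) auto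
  qed
qed

text \<open>One factor of the series. The quotient by \<open>N\<close> is first cut down to a finitely generated discrete
  one: an open normal subgroup \<open>M\<close> containing \<open>N\<close> moves \<open>U\<close> to finitely many sets, whose intersection is
  \<open>M\<close>-invariant. Now \<open>\<Gamma>\<close> is generated by \<open>M\<close> and a finite set \<open>F2\<close>. The elements of \<open>F2\<close> are made
  periodic one at a time by finite intersections, where periodicity of the earlier ones is kept because
  it passes to translates. Finally the conjugates of \<open>F2\<close> form a set to which Dietzmann's lemma
  applies, and intersecting the finitely many translates under the group they generate gives
  invariance under \<open>F2\<close> and \<open>M\<close>, hence under \<open>\<Gamma>\<close>.\<close>

theorem extend_invariance_to_group:
  assumes S: "locally_compact_space S" "Hausdorff_space S"
    and N: "N \<lhd> \<Gamma>"
    and cg: "compactly_generated (\<Gamma> Mod N) (quotient_topology S (\<lambda>y. N #> y))"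
    and rc: "relatively_compact_conjugacy_classes (\<Gamma> Mod N) (quotient_topology S (\<lambda>y. N #> y))"
    and U: "compact_open_nbhd U" and NU: "\<And>g. g \<in> N \<Longrightarrow> \<phi> g ` U = U"
  shows "\<exists>V\<subseteq>U. compact_open_nbhd V \<and> (\<forall>g\<in>carrier \<Gamma>. \<phi> g ` V = V)"
proof -
  let ?st = "\<lambda>X. stabilizer \<Gamma> (\<lambda>g V. \<phi> g ` V) X"
  have sg: "subgroup (?st X) \<Gamma>" if "compact_open_nbhd X" for X
    using sets.stabilizer_subgroup[OF PowI[OF compact_open_nbhd_subset[OF that]]] .
  have fin: "finite (sets.class_orbit h X)" if "compact_open_nbhd X" "N \<subseteq> ?st X" "h \<in> carrier \<Gamma>" for h X
    using sets.relatively_compact_classes_imp_finite_class_orbit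
      [OF N rc PowI[OF compact_open_nbhd_subset[OF that(1)]] openin_stabilizer[OF that(1)] that(2,3)] .
  have Nst: "N \<subseteq> ?st U"
    using NU subgroup.subset[OF normal_imp_subgroup[OF N]] by (auto simp: stabilizer_def)
  obtain F where F: "finite F" "F \<subseteq> carrier \<Gamma>" "generate \<Gamma> (F \<union> ?st U) = carrier \<Gamma>"
    using compactly_generated_quotient_imp_finitely_generated_over_open
      [OF N sg[OF U] openin_stabilizer[OF U] Nst cg] by blast
  have UE: "U \<in> Pow (topspace T)" using compact_open_nbhd_subset[OF U] by blast
  obtain M where M: "M \<lhd> \<Gamma>" "openin S M" "finite ((\<lambda>g. \<phi> g ` U) ` M)" "N \<subseteq> M"
    using sets.open_normal_subgroup_finite_orbit[OF S UE openin_stabilizer[OF U] F fin[OF U Nst]] N Nst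
    by blast
  note sM = normal_imp_subgroup[OF M(1)]
  let ?U = "\<Inter>h\<in>M. \<phi> h ` U"
  note U' = finite_orbit_intersection[OF sM U M(3)]
  obtain F2 where F2: "finite F2" "F2 \<subseteq> carrier \<Gamma>" "generate \<Gamma> (F2 \<union> M) = carrier \<Gamma>"
    using compactly_generated_quotient_imp_finitely_generated_over_open[OF N sM M(2,4) cg] by blast
  \<comment> \<open>Intersecting over powers of a new generator makes the set invariant under it; earlier generators stay periodic.\<close>
  have "\<exists>V\<subseteq>?U. compact_open_nbhd V \<and> M \<subseteq> ?st V \<and> (\<forall>f\<in>F2. sets.periodic f V)"
    using F2(1,2)
  proof (induction rule: finite_induct)
    case empty
    then show ?case using U' by blast
  next
    case (insert f F')
    then obtain V where V: "V \<subseteq> ?U" "compact_open_nbhd V" "M \<subseteq> ?st V" "\<forall>f\<in>F'. sets.periodic f V" by auto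
    have f: "f \<in> carrier \<Gamma>" using insert.prems by blast
    have VE: "V \<in> Pow (topspace T)" using compact_open_nbhd_subset[OF V(2)] by blast
    obtain n where n: "\<phi> f ` (\<Inter>i\<le>n. \<phi> (f [^] (i::nat)) ` V) = (\<Inter>i\<le>n. \<phi> (f [^] i) ` V)"
      using invariant_finite_intersection[OF f V(2)] by blast
    let ?V = "\<Inter>i\<le>n. \<phi> (f [^] i) ` V"
    have fi: "f [^] i \<in> carrier \<Gamma>" for i :: nat using f by simp
    have tr: "\<phi> (f [^] i) ` V \<in> Pow (topspace T)" for i :: nat using sets.act_closed[OF fi VE] .
    have "?V \<subseteq> V" using sets.act_one[OF VE] by (intro INF_lower2[of 0]) auto
    then have 1: "?V \<subseteq> ?U" using V(1) by blast
    have nV: "compact_open_nbhd ?V" using V(2) fi compact_open_nbhd_image by (intro compact_open_nbhd_Inter) auto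
    have img: "\<phi> g ` ?V = ?V"
      if g: "g \<in> carrier \<Gamma>" and "\<And>i. i \<le> n \<Longrightarrow> \<phi> g ` \<phi> (f [^] i) ` V = \<phi> (f [^] i) ` V" for g
    proof -
      have pre: "\<phi> g ` X = {x \<in> topspace T. \<phi> (inv g) x \<in> X}" if "X \<subseteq> topspace T" for X
        using image_\<phi>_eq_preimage[OF g that] .
      have "\<phi> g ` ?V = {x \<in> topspace T. \<phi> (inv g) x \<in> ?V}"
        using pre compact_open_nbhd_subset[OF nV] by blast
      also have "\<dots> = (\<Inter>i\<le>n. {x \<in> topspace T. \<phi> (inv g) x \<in> \<phi> (f [^] i) ` V})" by auto
      also have "\<dots> = (\<Inter>i\<le>n. \<phi> g ` \<phi> (f [^] i) ` V)"
        using pre tr by (intro INF_cong) auto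
      also have "\<dots> = ?V" using that(2) by (intro INF_cong) auto
      finally show ?thesis .
    qed
    have "M \<subseteq> ?st ?V"
    proof
      fix m assume m: "m \<in> M"
      then have mc: "m \<in> carrier \<Gamma>" using subgroup.subset[OF sM] by blast
      have "\<phi> m ` \<phi> (f [^] i) ` V = \<phi> (f [^] i) ` V" for i :: nat
        using subsetD[OF sets.normal_fixes_translate[OF M(1) VE V(3) fi] m] by (simp add: stabilizer_def)
      then have "\<phi> m ` ?V = ?V" using img[OF mc] by blast
      then show "m \<in> ?st ?V" using mc unfolding stabilizer_def by blast
    qed
    moreover have "sets.periodic f' ?V" if f': "f' \<in> F'" for f'
    proof -
      have f'c: "f' \<in> carrier \<Gamma>" using insert.prems f' by blast
      have "finite (sets.class_orbit (f [^] i) V)" for i :: nat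
        using fin[OF V(2) order_trans[OF M(4) V(3)] fi] .
      then have "sets.periodic f' (\<phi> (f [^] i) ` V)" for i :: nat
        using sets.periodic_translate[OF f'c fi VE] V(4) f' by blast
      then have "\<exists>k>0. \<forall>i\<in>{..n}. \<phi> (f' [^] (k::nat)) ` \<phi> (f [^] i) ` V = \<phi> (f [^] i) ` V"
        using tr by (intro sets.periodic_common_power[OF f'c]) auto
      then obtain k where k: "k > 0" "\<forall>i\<in>{..n}. \<phi> (f' [^] (k::nat)) ` \<phi> (f [^] i) ` V = \<phi> (f [^] i) ` V"
        by blast
      then have "\<phi> (f' [^] k) ` ?V = ?V" using f'c by (intro img) (blast intro: nat_pow_closed)+
      then show ?thesis using k(1) unfolding sets.periodic_def by blast
    qed
    moreover have "sets.periodic f ?V" using sets.periodicI[OF f n] .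
    ultimately show ?case using 1 nV by (intro exI[of _ ?V]) auto
  qed
  then obtain V where V: "V \<subseteq> ?U" "compact_open_nbhd V" "M \<subseteq> ?st V" "\<And>f. f \<in> F2 \<Longrightarrow> sets.periodic f V" by blast
  have VE: "V \<in> Pow (topspace T)" using compact_open_nbhd_subset[OF V(2)] by blast
  have finV: "finite (sets.class_orbit h V)" if "h \<in> carrier \<Gamma>" for h
    using fin[OF V(2) order_trans[OF M(4) V(3)] that] .
  \<comment> \<open>Conjugates of elements periodic at \<open>V\<close> are periodic at \<open>V\<close>, so the finite-orbit theorem applies to \<open>D\<close>.\<close>
  define D where "D = (\<Union>f\<in>F2. conjugacy_class \<Gamma> f)"
  have Dc: "D \<subseteq> carrier \<Gamma>" unfolding D_def using conjugacy_class_carrier F2(2) by blast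
  interpret D: conjugation_stable_set \<Gamma> "Pow (topspace T)" "\<lambda>g V. \<phi> g ` V" D V
  proof
    show "g \<otimes> d \<otimes> inv g \<in> D" if "g \<in> carrier \<Gamma>" "d \<in> D" for g d
      using that conjugacy_class_conj_closed F2(2) unfolding D_def by blast
    have "(\<lambda>d. \<phi> d ` V) ` D = (\<Union>f\<in>F2. sets.class_orbit f V)"
      by (auto simp: D_def sets.class_orbit_def)
    then show "finite ((\<lambda>d. \<phi> d ` V) ` D)" using F2 finV by auto
    show "sets.periodic d V" if d: "d \<in> D" for d
    proof -
      obtain f g where "f \<in> F2" "g \<in> carrier \<Gamma>" "d = g \<otimes> f \<otimes> inv g"
        using d by (auto simp: D_def conjugacy_class_def)
      then show ?thesis using sets.periodic_conj[of f g V] VE V(4) F2(2) finV by auto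
    qed
  qed (use Dc VE in auto)
  let ?H = "generate \<Gamma> D"
  have sH: "subgroup ?H \<Gamma>" using Dc by (rule generate_is_subgroup)
  let ?V = "\<Inter>h\<in>?H. \<phi> h ` V"
  note V' = finite_orbit_intersection[OF sH V(2) D.finite_orbit_generate]
  have "F2 \<subseteq> D" unfolding D_def using self_in_conjugacy_class F2(2) by blast
  then have "F2 \<subseteq> ?H" by (auto intro: generate.incl)
  then have "F2 \<union> M \<subseteq> ?st ?V" using V'(3) V'(4)[OF M(1) V(3)] by blast
  then have "carrier \<Gamma> \<subseteq> ?st ?V" using generate_subgroup_incl[OF _ sg[OF V'(1)]] F2(3) by metis
  then have "\<forall>g\<in>carrier \<Gamma>. \<phi> g ` ?V = ?V" unfolding stabilizer_def by blast
  moreover have "?V \<subseteq> U" by (rule order_trans[OF V'(2) order_trans[OF V(1) U'(2)]])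
  ultimately show ?thesis using V'(1) by (intro exI[of _ ?V] conjI)
qed

end

section \<open>The three properties on totally disconnected groups\<close>

lemma (in topological_group) subgroup_topological_group:
  assumes H: "subgroup H G"
  shows "topological_group (G\<lparr>carrier := H\<rparr>) (subtopology T H)"
proof -
  interpret H: group "G\<lparr>carrier := H\<rparr>" using H by (rule subgroup_imp_group)
  have HG: "H \<subseteq> carrier G" using H by (rule subgroup.subset)
  then have tH: "topspace (subtopology T H) = H" using topspace_eq_carrier by auto
  show ?thesis
  proof unfold_locales
    show "topspace (subtopology T H) = carrier (G\<lparr>carrier := H\<rparr>)" using tH by simp
    have "continuous_map (subtopology (prod_topology T T) (H \<times> H)) T (\<lambda>(x, y). x \<otimes> y)"
      using continuous_mult by (rule continuous_map_from_subtopology)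
    then show "continuous_map (prod_topology (subtopology T H) (subtopology T H)) (subtopology T H)
            (\<lambda>(x, y). x \<otimes>\<^bsub>G\<lparr>carrier := H\<rparr>\<^esub> y)"
      using subgroup.m_closed[OF H] by (auto simp: continuous_map_in_subtopology subtopology_Times)
    have "continuous_map (subtopology T H) (subtopology T H) (\<lambda>x. inv x)"
      using continuous_inv subgroup.m_inv_closed[OF H]
      by (auto simp: continuous_map_in_subtopology intro!: continuous_map_from_subtopology)
    then show "continuous_map (subtopology T H) (subtopology T H) (\<lambda>x. inv\<^bsub>G\<lparr>carrier := H\<rparr>\<^esub> x)"
      by (rule continuous_map_eq) (use m_inv_consistent[OF H] tH in auto)
  qed
qed

context pointed_action
begin

lemma subgroup_pointed_action:
  assumes H: "subgroup H \<Gamma>"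
  shows "pointed_action (\<Gamma>\<lparr>carrier := H\<rparr>) (subtopology S H) T \<phi> e"
proof -
  interpret H: topological_group "\<Gamma>\<lparr>carrier := H\<rparr>" "subtopology S H"
    using H by (rule subgroup_topological_group)
  have HG: "H \<subseteq> carrier \<Gamma>" using H by (rule subgroup.subset)
  show ?thesis
  proof unfold_locales
    have "continuous_map (subtopology (prod_topology S T) (H \<times> topspace T)) T (\<lambda>(\<gamma>, x). \<phi> \<gamma> x)"
      using \<phi>_continuous by (rule continuous_map_from_subtopology)
    then show "continuous_map (prod_topology (subtopology S H) T) T (\<lambda>(\<gamma>, x). \<phi> \<gamma> x)"
      by (simp add: subtopology_Times)
    show "distal_action (\<Gamma>\<lparr>carrier := H\<rparr>) T \<phi>"
      unfolding distal_action_def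
    proof (intro ballI impI)
      fix x y assume xy: "x \<in> topspace T" "y \<in> topspace T" "x \<noteq> y"
      have "prod_topology T T closure_of {(\<phi> \<gamma> x, \<phi> \<gamma> y) | \<gamma>. \<gamma> \<in> carrier (\<Gamma>\<lparr>carrier := H\<rparr>)}
          \<subseteq> prod_topology T T closure_of {(\<phi> \<gamma> x, \<phi> \<gamma> y) | \<gamma>. \<gamma> \<in> carrier \<Gamma>}"
        using HG by (intro closure_of_mono) auto
      moreover have "(prod_topology T T closure_of {(\<phi> \<gamma> x, \<phi> \<gamma> y) | \<gamma>. \<gamma> \<in> carrier \<Gamma>}) \<inter>
          {(z, z) | z. z \<in> topspace T} = {}"
        using distal xy unfolding distal_action_def by blast
      ultimately show "(prod_topology T T closure_of {(\<phi> \<gamma> x, \<phi> \<gamma> y) | \<gamma>. \<gamma> \<in> carrier (\<Gamma>\<lparr>carrier := H\<rparr>)}) \<inter>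
          {(z, z) | z. z \<in> topspace T} = {}"
        by blast
    qed
  qed (use \<phi>_one \<phi>_mult \<phi>_base_point base_point Hausdorff in \<open>auto simp: subsetD[OF HG]\<close>)
qed

text \<open>Induction up the series, starting from the trivial group \<open>L n\<close>.\<close>

theorem invariant_compact_open_nbhd:
  assumes FC: "generalised_FC_group \<Gamma> S" and U: "compact_open_nbhd U"
  shows "\<exists>V\<subseteq>U. compact_open_nbhd V \<and> (\<forall>g\<in>carrier \<Gamma>. \<phi> g ` V = V)"
proof -
  interpret LC: locally_compact_group \<Gamma> S using FC by (simp add: generalised_FC_group_def)
  obtain n :: nat and L where L0: "L 0 = carrier \<Gamma>" and Ln: "L n = {\<one>}"
    and L: "\<And>i. i \<le> n \<Longrightarrow> L i \<lhd> \<Gamma> \<and> closedin S (L i)"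
    and step: "\<And>i. i < n \<Longrightarrow> L (Suc i) \<subseteq> L i \<and>
           (let Gi = \<Gamma>\<lparr>carrier := L i\<rparr>;
                Q = Gi Mod L (Suc i);
                TQ = quotient_topology (subtopology S (L i)) (\<lambda>x. L (Suc i) #>\<^bsub>Gi\<^esub> x)
            in compactly_generated Q TQ \<and> relatively_compact_conjugacy_classes Q TQ)"
    using FC unfolding generalised_FC_group_def by auto
  have "\<exists>V\<subseteq>U. compact_open_nbhd V \<and> (\<forall>g\<in>L 0. \<phi> g ` V = V)"
  proof (rule inc_induct[of 0 n])
    show "\<exists>V\<subseteq>U. compact_open_nbhd V \<and> (\<forall>g\<in>L n. \<phi> g ` V = V)"
      using U sets.act_one[OF PowI[OF compact_open_nbhd_subset[OF U]]] Ln by (intro exI[of _ U]) auto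
  next
    fix i assume i: "i < n" and IH: "\<exists>V\<subseteq>U. compact_open_nbhd V \<and> (\<forall>g\<in>L (Suc i). \<phi> g ` V = V)"
    then obtain V where V: "V \<subseteq> U" "compact_open_nbhd V" "\<And>g. g \<in> L (Suc i) \<Longrightarrow> \<phi> g ` V = V" by auto
    have sub: "subgroup (L i) \<Gamma>" and clo: "closedin S (L i)"
      using L[of i] i normal_imp_subgroup by auto
    have nor: "L (Suc i) \<lhd> \<Gamma>\<lparr>carrier := L i\<rparr>"
      using normal_restrict_supergroup[OF sub] L[of "Suc i"] i step[OF i] by auto
    interpret Li: pointed_action "\<Gamma>\<lparr>carrier := L i\<rparr>" "subtopology S (L i)" T \<phi> e
      using sub by (rule subgroup_pointed_action)
    have lc: "locally_compact_space (subtopology S (L i))"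
      using LC.locally_compact clo by (rule locally_compact_space_closed_subset)
    have ha: "Hausdorff_space (subtopology S (L i))"
      using LC.Hausdorff by (rule Hausdorff_space_subtopology)
    note factor = step[OF i, unfolded Let_def, THEN conjunct2]
    have "\<exists>V'\<subseteq>V. compact_open_nbhd V' \<and> (\<forall>g\<in>carrier (\<Gamma>\<lparr>carrier := L i\<rparr>). \<phi> g ` V' = V')"
      by (rule Li.extend_invariance_to_group[OF lc ha nor factor[THEN conjunct1] factor[THEN conjunct2] V(2,3)])
    then obtain V' where "V' \<subseteq> V" "compact_open_nbhd V'" "\<forall>g\<in>L i. \<phi> g ` V' = V'" by auto
    then show "\<exists>V\<subseteq>U. compact_open_nbhd V \<and> (\<forall>g\<in>L i. \<phi> g ` V = V)"
      using V(1) by (intro exI[of _ V'] conjI order_trans[of V' V U])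
  qed simp
  then show ?thesis using L0 by simp
qed

end

text \<open>The component \<open>{x}\<close> is compact, so in a locally compact Hausdorff space it can be separated from the
  complement of any neighbourhood by a partition into two open sets.\<close>

lemma compact_open_neighbourhood_base:
  assumes lc: "locally_compact_space X" and haus: "Hausdorff_space X" and td: "totally_disconnected_space X"
    and W: "openin X W" "x \<in> W"
  shows "\<exists>V\<subseteq>W. compactin X V \<and> openin X V \<and> x \<in> V"
proof -
  have x: "x \<in> topspace X" using W openin_subset by blast
  obtain U K where UK: "openin X U" "compactin X K" "x \<in> U" "U \<subseteq> K"
    using lc x unfolding locally_compact_space_def by blast
  have "connectedin X (connected_component_of_set X x)" by (rule connectedin_connected_component_of)
  then obtain a where "connected_component_of_set X x \<subseteq> {a}"
    using td unfolding totally_disconnected_space_def by blast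
  moreover have "x \<in> connected_component_of_set X x" using x by (simp add: connected_component_of_refl)
  ultimately have "connected_component_of_set X x = {x}" by blast
  then have comp: "{x} \<in> connected_components_of X"
    using x unfolding connected_components_of_def by (metis imageI)
  have "compactin X {x}" using x by simp
  moreover have "openin X (W \<inter> U)" using W UK by blast
  moreover have "{x} \<subseteq> W \<inter> U" using W UK by blast
  ultimately obtain A B where AB: "openin X A" "openin X B" "disjnt A B" "A \<union> B = topspace X" "{x} \<subseteq> A" "A \<subseteq> W \<inter> U"
    by (rule wilder_locally_compact_component_thm[OF lc haus comp])
  have "A = topspace X - B" using AB(3,4) by (auto simp: disjnt_def)
  then have "closedin X A" using AB(2) by blast
  then have "compactin X A" using closed_compactin[OF UK(2)] AB(6) UK(4) by blast
  then show ?thesis using AB by blast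
qed

context continuous_automorphism_action
begin

lemma \<phi>_hom: "\<gamma> \<in> carrier \<Gamma> \<Longrightarrow> \<phi> \<gamma> \<in> hom G G"
  using action_hom by (auto simp: hom_def AutoGroup_def auto_def)

lemma \<phi>_Bij: "\<gamma> \<in> carrier \<Gamma> \<Longrightarrow> \<phi> \<gamma> \<in> Bij (carrier G)"
  using action_hom by (auto simp: hom_def AutoGroup_def auto_def)

lemma \<phi>_closed: "\<gamma> \<in> carrier \<Gamma> \<Longrightarrow> x \<in> carrier G \<Longrightarrow> \<phi> \<gamma> x \<in> carrier G"
  using \<phi>_hom by (auto simp: hom_def)

lemma \<phi>_prod:
  "\<gamma> \<in> carrier \<Gamma> \<Longrightarrow> x \<in> carrier G \<Longrightarrow> y \<in> carrier G \<Longrightarrow> \<phi> \<gamma> (x \<otimes>\<^bsub>G\<^esub> y) = \<phi> \<gamma> x \<otimes>\<^bsub>G\<^esub> \<phi> \<gamma> y"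
  using \<phi>_hom by (auto simp: hom_def)

lemma \<phi>_group_hom: "\<gamma> \<in> carrier \<Gamma> \<Longrightarrow> group_hom G G (\<phi> \<gamma>)"
  using \<phi>_hom by (simp add: group_hom_def group_hom_axioms_def G.is_group)

lemma \<phi>_compose:
  assumes "\<gamma> \<in> carrier \<Gamma>" "\<delta> \<in> carrier \<Gamma>" "x \<in> carrier G"
  shows "\<phi> (\<gamma> \<otimes>\<^bsub>\<Gamma>\<^esub> \<delta>) x = \<phi> \<gamma> (\<phi> \<delta> x)"
proof -
  have "\<phi> (\<gamma> \<otimes>\<^bsub>\<Gamma>\<^esub> \<delta>) = \<phi> \<gamma> \<otimes>\<^bsub>AutoGroup G\<^esub> \<phi> \<delta>"
    using action_hom assms by (simp add: hom_mult)
  also have "\<dots> = compose (carrier G) (\<phi> \<gamma>) (\<phi> \<delta>)"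
    using \<phi>_Bij assms by (simp add: AutoGroup_def BijGroup_def)
  finally show ?thesis using assms(3) by (simp add: compose_def)
qed

lemma \<phi>_identity:
  assumes "x \<in> carrier G"
  shows "\<phi> \<one>\<^bsub>\<Gamma>\<^esub> x = x"
proof -
  have "group_hom \<Gamma> (AutoGroup G) \<phi>"
    using action_hom G.AutoGroup \<Gamma>.is_group by (simp add: group_hom_def group_hom_axioms_def)
  then have "\<phi> \<one>\<^bsub>\<Gamma>\<^esub> = \<one>\<^bsub>AutoGroup G\<^esub>" by (rule group_hom.hom_one)
  then show ?thesis using assms by (simp add: AutoGroup_def BijGroup_def)
qed

lemma pointed_action_of_distal:
  assumes "Hausdorff_space T" "distal_action \<Gamma> T \<phi>"
  shows "pointed_action \<Gamma> S T \<phi> \<one>\<^bsub>G\<^esub>"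
proof unfold_locales
  show "\<phi> g \<one>\<^bsub>G\<^esub> = \<one>\<^bsub>G\<^esub>" if "g \<in> carrier \<Gamma>" for g
    using \<phi>_group_hom[OF that] by (rule group_hom.hom_one)
qed (use assms \<phi>_identity \<phi>_compose action_continuous G.topspace_eq_carrier in auto)

lemma orbit_closure_transitive:
  assumes x: "x \<in> carrier G" and y: "y \<in> T closure_of orbit \<Gamma> \<phi> x"
  shows "T closure_of orbit \<Gamma> \<phi> y \<subseteq> T closure_of orbit \<Gamma> \<phi> x"
proof (rule closure_of_minimal)
  show "orbit \<Gamma> \<phi> y \<subseteq> T closure_of orbit \<Gamma> \<phi> x"
  proof
    fix z assume "z \<in> orbit \<Gamma> \<phi> y"
    then obtain \<gamma> where \<gamma>: "\<gamma> \<in> carrier \<Gamma>" "z = \<phi> \<gamma> y" by (auto simp: orbit_def)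
    have "continuous_map T T (\<phi> \<gamma>)"
      using action_homeomorphic[OF \<gamma>(1)] by (rule homeomorphic_imp_continuous_map)
    then have "\<phi> \<gamma> ` (T closure_of orbit \<Gamma> \<phi> x) \<subseteq> T closure_of (\<phi> \<gamma> ` orbit \<Gamma> \<phi> x)"
      by (rule continuous_map_image_closure_subset)
    also have "\<phi> \<gamma> ` orbit \<Gamma> \<phi> x \<subseteq> orbit \<Gamma> \<phi> x"
    proof
      fix w assume "w \<in> \<phi> \<gamma> ` orbit \<Gamma> \<phi> x"
      then obtain \<delta> where "\<delta> \<in> carrier \<Gamma>" "w = \<phi> \<gamma> (\<phi> \<delta> x)" by (auto simp: orbit_def)
      then have "w = \<phi> (\<gamma> \<otimes>\<^bsub>\<Gamma>\<^esub> \<delta>) x" "\<gamma> \<otimes>\<^bsub>\<Gamma>\<^esub> \<delta> \<in> carrier \<Gamma>" using \<phi>_compose \<gamma>(1) x by auto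
      then show "w \<in> orbit \<Gamma> \<phi> x" by (auto simp: orbit_def)
    qed
    then have "T closure_of (\<phi> \<gamma> ` orbit \<Gamma> \<phi> x) \<subseteq> T closure_of orbit \<Gamma> \<phi> x"
      by (rule closure_of_mono)
    finally show "z \<in> T closure_of orbit \<Gamma> \<phi> x" using y \<gamma>(2) by blast
  qed
qed simp

text \<open>If \<open>\<phi> \<gamma> x\<close> and \<open>\<phi> \<gamma> y\<close> come arbitrarily close near some point, then the quotients
  \<open>\<phi> \<gamma> (x\<^sup>-\<^sup>1 y)\<close> come arbitrarily close to the identity. The orbit closure of \<open>x\<^sup>-\<^sup>1 y\<close> then
  contains the fixed identity, and minimality makes it trivial.\<close>

lemma minimal_orbit_closures_imp_distal:
  assumes haus: "Hausdorff_space T" and MOC: "minimal_orbit_closures \<Gamma> T \<phi>"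
  shows "distal_action \<Gamma> T \<phi>"
  unfolding distal_action_def
proof (intro ballI impI)
  fix x y assume xy: "x \<in> topspace T" "y \<in> topspace T" "x \<noteq> y"
  then have c: "x \<in> carrier G" "y \<in> carrier G" using G.topspace_eq_carrier by auto
  define w where "w = inv\<^bsub>G\<^esub> x \<otimes>\<^bsub>G\<^esub> y"
  have w: "w \<in> carrier G" using c by (simp add: w_def)
  let ?A = "{(\<phi> \<gamma> x, \<phi> \<gamma> y) | \<gamma>. \<gamma> \<in> carrier \<Gamma>}"
  let ?d = "\<lambda>p. inv\<^bsub>G\<^esub> (fst p) \<otimes>\<^bsub>G\<^esub> snd p"
  show "(prod_topology T T closure_of ?A) \<inter> {(z, z) | z. z \<in> topspace T} = {}"
  proof (rule ccontr)
    assume "\<not> ?thesis"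
    then obtain z where z: "z \<in> topspace T" "(z, z) \<in> prod_topology T T closure_of ?A" by blast
    have "continuous_map (prod_topology T T) T ?d"
      using continuous_map_compose[OF continuous_map_fst G.continuous_inv] continuous_map_snd
      by (intro G.continuous_map_mult) (auto simp: o_def)
    then have "?d ` (prod_topology T T closure_of ?A) \<subseteq> T closure_of (?d ` ?A)"
      by (rule continuous_map_image_closure_subset)
    moreover have "?d ` ?A \<subseteq> orbit \<Gamma> \<phi> w"
    proof
      fix v assume "v \<in> ?d ` ?A"
      then obtain \<gamma> where \<gamma>: "\<gamma> \<in> carrier \<Gamma>" "v = inv\<^bsub>G\<^esub> (\<phi> \<gamma> x) \<otimes>\<^bsub>G\<^esub> \<phi> \<gamma> y" by auto
      then have "v = \<phi> \<gamma> w"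
        using \<phi>_prod[OF \<gamma>(1)] group_hom.hom_inv[OF \<phi>_group_hom[OF \<gamma>(1)] c(1)] c by (simp add: w_def)
      then show "v \<in> orbit \<Gamma> \<phi> w" using \<gamma>(1) by (auto simp: orbit_def)
    qed
    then have "T closure_of (?d ` ?A) \<subseteq> T closure_of orbit \<Gamma> \<phi> w" by (rule closure_of_mono)
    moreover have "?d (z, z) = \<one>\<^bsub>G\<^esub>" using z(1) G.topspace_eq_carrier by simp
    ultimately have "\<one>\<^bsub>G\<^esub> \<in> T closure_of orbit \<Gamma> \<phi> w" using z(2) by (metis (no_types, lifting) image_eqI subsetD)
    then have eq: "T closure_of orbit \<Gamma> \<phi> \<one>\<^bsub>G\<^esub> = T closure_of orbit \<Gamma> \<phi> w"
      using MOC w G.topspace_eq_carrier unfolding minimal_orbit_closures_def by blast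
    have "orbit \<Gamma> \<phi> \<one>\<^bsub>G\<^esub> \<subseteq> {\<one>\<^bsub>G\<^esub>}"
      using group_hom.hom_one[OF \<phi>_group_hom] by (auto simp: orbit_def)
    moreover have "closedin T {\<one>\<^bsub>G\<^esub>}"
      using haus G.topspace_eq_carrier by (simp add: closedin_Hausdorff_sing_eq)
    ultimately have "T closure_of orbit \<Gamma> \<phi> \<one>\<^bsub>G\<^esub> \<subseteq> {\<one>\<^bsub>G\<^esub>}" by (rule closure_of_minimal)
    moreover have "w \<in> orbit \<Gamma> \<phi> w"
      using \<phi>_identity[OF w] unfolding orbit_def by (intro CollectI exI[of _ "\<one>\<^bsub>\<Gamma>\<^esub>"]) auto
    moreover have "orbit \<Gamma> \<phi> w \<subseteq> T closure_of orbit \<Gamma> \<phi> w"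
      using \<phi>_closed w G.topspace_eq_carrier by (intro closure_of_subset) (auto simp: orbit_def)
    ultimately have "w = \<one>\<^bsub>G\<^esub>" using eq by blast
    then show False using xy(3) c unfolding w_def
      by (metis G.inv_closed G.inv_equality G.inv_inv G.inv_comm)
  qed
qed

text \<open>If \<open>\<phi> \<gamma> x\<close> is close to \<open>y\<close> up to an invariant neighbourhood of the identity, then \<open>\<phi> \<gamma>\<^sup>-\<^sup>1 y\<close> is equally
  close to \<open>x\<close>. So membership in orbit closures is symmetric.\<close>

lemma equicontinuous_imp_minimal_orbit_closures:
  assumes eq: "equicontinuous_action \<Gamma> G T \<phi>"
  shows "minimal_orbit_closures \<Gamma> T \<phi>"
  unfolding minimal_orbit_closures_def
proof (intro ballI impI subset_antisym)
  fix x y assume "x \<in> topspace T" "y \<in> topspace T" and y: "y \<in> T closure_of orbit \<Gamma> \<phi> x"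
  then have c: "x \<in> carrier G" "y \<in> carrier G" using G.topspace_eq_carrier by auto
  show "T closure_of orbit \<Gamma> \<phi> y \<subseteq> T closure_of orbit \<Gamma> \<phi> x"
    using c(1) y by (rule orbit_closure_transitive)
  have "x \<in> T closure_of orbit \<Gamma> \<phi> y"
    unfolding in_closure_of
  proof (intro conjI allI impI)
    show "x \<in> topspace T" by fact
    fix W assume W: "x \<in> W \<and> openin T W"
    have "continuous_map T T (\<lambda>g. x \<otimes>\<^bsub>G\<^esub> g)"
      using G.continuous_map_const_mult[OF c(1), of T "\<lambda>g. g"] by simp
    then have "openin T {g \<in> topspace T. x \<otimes>\<^bsub>G\<^esub> g \<in> W}"
      using W openin_continuous_map_preimage by blast
    moreover have "\<one>\<^bsub>G\<^esub> \<in> {g \<in> topspace T. x \<otimes>\<^bsub>G\<^esub> g \<in> W}" using W c G.topspace_eq_carrier by simp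
    ultimately obtain U V where UV: "openin T U" "\<forall>\<gamma>\<in>carrier \<Gamma>. \<phi> \<gamma> ` V = V" "\<one>\<^bsub>G\<^esub> \<in> U" "U \<subseteq> V"
        "V \<subseteq> {g \<in> topspace T. x \<otimes>\<^bsub>G\<^esub> g \<in> W}"
      using eq unfolding equicontinuous_action_def neighbourhood_base_at_def by meson
    have "continuous_map T T (\<lambda>g. inv\<^bsub>G\<^esub> g \<otimes>\<^bsub>G\<^esub> y)"
      using G.continuous_map_mult_const[OF c(2) G.continuous_inv] .
    then have "openin T {g \<in> topspace T. inv\<^bsub>G\<^esub> g \<otimes>\<^bsub>G\<^esub> y \<in> U}"
      using UV(1) openin_continuous_map_preimage by blast
    moreover have "y \<in> {g \<in> topspace T. inv\<^bsub>G\<^esub> g \<otimes>\<^bsub>G\<^esub> y \<in> U}" using UV(3) c G.topspace_eq_carrier by simp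
    ultimately have "\<exists>v. v \<in> orbit \<Gamma> \<phi> x \<and> v \<in> {g \<in> topspace T. inv\<^bsub>G\<^esub> g \<otimes>\<^bsub>G\<^esub> y \<in> U}"
      by (intro y[unfolded in_closure_of, THEN conjunct2, rule_format] conjI)
    then obtain v where "v \<in> orbit \<Gamma> \<phi> x" "inv\<^bsub>G\<^esub> v \<otimes>\<^bsub>G\<^esub> y \<in> U" by blast
    then obtain \<gamma> where \<gamma>: "\<gamma> \<in> carrier \<Gamma>" and "inv\<^bsub>G\<^esub> (\<phi> \<gamma> x) \<otimes>\<^bsub>G\<^esub> y \<in> V"
      using UV(4) by (auto simp: orbit_def)
    define \<delta> where "\<delta> = inv\<^bsub>\<Gamma>\<^esub> \<gamma>"
    have \<delta>: "\<delta> \<in> carrier \<Gamma>" using \<gamma> by (simp add: \<delta>_def)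
    have "\<phi> \<delta> (\<phi> \<gamma> x) = x"
      using \<phi>_compose[OF \<delta> \<gamma> c(1)] \<phi>_identity[OF c(1)] \<gamma> by (simp add: \<delta>_def)
    then have "\<phi> \<delta> (inv\<^bsub>G\<^esub> (\<phi> \<gamma> x) \<otimes>\<^bsub>G\<^esub> y) = inv\<^bsub>G\<^esub> x \<otimes>\<^bsub>G\<^esub> \<phi> \<delta> y"
      using \<phi>_prod[OF \<delta>] group_hom.hom_inv[OF \<phi>_group_hom[OF \<delta>]] \<phi>_closed[OF \<gamma> c(1)] c by simp
    moreover have "\<phi> \<delta> (inv\<^bsub>G\<^esub> (\<phi> \<gamma> x) \<otimes>\<^bsub>G\<^esub> y) \<in> V"
      using UV(2) \<delta> \<open>inv\<^bsub>G\<^esub> (\<phi> \<gamma> x) \<otimes>\<^bsub>G\<^esub> y \<in> V\<close> by blast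
    ultimately have "x \<otimes>\<^bsub>G\<^esub> (inv\<^bsub>G\<^esub> x \<otimes>\<^bsub>G\<^esub> \<phi> \<delta> y) \<in> W" using UV(5) by auto
    then have "\<phi> \<delta> y \<in> W"
      using c \<phi>_closed[OF \<delta> c(2)] by (simp add: G.m_assoc[symmetric])
    then show "\<exists>z. z \<in> orbit \<Gamma> \<phi> y \<and> z \<in> W" using \<delta> by (auto simp: orbit_def)
  qed
  with c(2) show "T closure_of orbit \<Gamma> \<phi> x \<subseteq> T closure_of orbit \<Gamma> \<phi> y"
    by (rule orbit_closure_transitive)
qed

lemma distal_imp_equicontinuous:
  assumes "locally_compact_space T" "Hausdorff_space T" "totally_disconnected_space T"
    and FC: "generalised_FC_group \<Gamma> S" and distal: "distal_action \<Gamma> T \<phi>"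
  shows "equicontinuous_action \<Gamma> G T \<phi>"
  unfolding equicontinuous_action_def neighbourhood_base_at_def
proof (intro allI impI)
  interpret pointed_action \<Gamma> S T \<phi> "\<one>\<^bsub>G\<^esub>"
    using assms(2) distal by (rule pointed_action_of_distal)
  fix W assume W: "openin T W \<and> \<one>\<^bsub>G\<^esub> \<in> W"
  then obtain U where U: "U \<subseteq> W" "compact_open_nbhd U"
    using compact_open_neighbourhood_base[OF assms(1-3), of W "\<one>\<^bsub>G\<^esub>"] unfolding compact_open_nbhd_def by auto
  obtain V where V: "V \<subseteq> U" "compact_open_nbhd V" "\<forall>g\<in>carrier \<Gamma>. \<phi> g ` V = V"
    using invariant_compact_open_nbhd[OF FC U(2)] by auto
  then have "openin T V" "\<one>\<^bsub>G\<^esub> \<in> V" by (simp_all add: compact_open_nbhd_def)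
  then show "\<exists>U V. openin T U \<and> (\<forall>\<gamma>\<in>carrier \<Gamma>. \<phi> \<gamma> ` V = V) \<and> \<one>\<^bsub>G\<^esub> \<in> U \<and> U \<subseteq> V \<and> V \<subseteq> W"
    using V(3) order_trans[OF V(1) U(1)] by (intro exI[of _ V] conjI order_refl)
qed

end

theorem proposition1p5:
  fixes \<Gamma> :: "('g, 'm) monoid_scheme" and S :: "'g topology"
    and G :: "('a, 'n) monoid_scheme" and T :: "'a topology"
    and \<phi> :: "'g \<Rightarrow> 'a \<Rightarrow> 'a"
  assumes "locally_compact_group G T"
    and "totally_disconnected_space T"
    and "generalised_FC_group \<Gamma> S"
    and "continuous_automorphism_action \<Gamma> S G T \<phi>"
  shows "(distal_action \<Gamma> T \<phi> \<longleftrightarrow> minimal_orbit_closures \<Gamma> T \<phi>) \<and>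
         (minimal_orbit_closures \<Gamma> T \<phi> \<longleftrightarrow> equicontinuous_action \<Gamma> G T \<phi>)"
proof -
  interpret G: locally_compact_group G T by fact
  interpret continuous_automorphism_action \<Gamma> S G T \<phi> by fact
  show ?thesis
    using distal_imp_equicontinuous[OF G.locally_compact G.Hausdorff assms(2,3)]
      equicontinuous_imp_minimal_orbit_closures minimal_orbit_closures_imp_distal[OF G.Hausdorff]
    by blast
qed

end
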